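(* Given a distance-hereditary graph $G$ and a decomposition tree $T$ of $G$, the following algorithm computes the independent Roman domination number $i_R(G)$ in linear time. Algorithm. Input: a distance-hereditary graph $G$ and a decomposition tree $T$ of $G$. Compute a BFS ordering $(v_1,\dots,v_r)$ of the internal vertices of $T$. For every leaf of $T$, with $H$ the single-vertex graph it represents, set $u^{00}(H)=0$, $u^0(H)=\infty$, $u^1(H)=1$, $u^2(H)=2$, $i_R(H)=1$. Then for $i=r,r-1,\dots,1$, let $G_i$ be the graph represented by the subtree of $T$ rooted at $v_i$, let $G_l$ and $G_r$ be the graphs represented by the subtrees rooted at the left and right child of $v_i$, and do the following. (a) If $v_i$ has label $\otimes$, set $u^2(G_i)=\min\{u^2(G_l)+u^{00}(G_r),\ u^{00}(G_l)+u^2(G_r)\}$, $u^1(G_i)=\min\{u^1(G_l)+u^0(G_r),\ u^0(G_l)+u^1(G_r)\}$, $u^0(G_i)=u^0(G_l)+u^0(G_r)$, $u^{00}(G_i)=u^{00}(G_l)+u^{00}(G_r)$. (b) If $v_i$ has label $\odot$, set $u^2(G_i)=\min\{u^2(G_l)+i_R(G_r),\ i_R(G_l)+u^2(G_r)\}$, $u^1(G_i)=\min\{u^1(G_l)+u^0(G_r),\ u^0(G_l)+u^1(G_r),\ u^1(G_l)+u^1(G_r)\}$, $u^0(G_i)=u^0(G_l)+u^0(G_r)$, $u^{00}(G_i)=u^{00}(G_l)+u^{00}(G_r)$. (c) Otherwise ($v_i$ has label $\oplus$), set $u^2(G_i)=u^2(G_l)+u^{00}(G_r)$, $u^1(G_i)=u^1(G_l)+u^0(G_r)$,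 $u^0(G_i)=\min\{u^{00}(G_l)+u^2(G_r),\ u^0(G_l)+u^1(G_r),\ u^0(G_l)+u^0(G_r)\}$, $u^{00}(G_i)=u^{00}(G_l)+i_R(G_r)$. In each of the three cases then set $i_R(G_i)=\min\{u^0(G_i),u^1(G_i),u^2(G_i)\}$. After the loop, return $i_R(G_1)$.
   Context: All graphs are finite, simple, undirected and nontrivial (at least two vertices), except for the single-vertex graphs used as building blocks below. For a graph $G=(V,E)$, an independent Roman dominating function (IRDF) of $G$ is a function $f:V\to\{0,1,2\}$ such that (i) every $v\in V$ with $f(v)=0$ has a neighbour $u$ with $f(u)=2$, and (ii) the set $\{v\in V: f(v)\in\{1,2\}\}$ is independent. Its weight is $w(f)=\sum_{v\in V}f(v)$, and $i_R(G)=\min\{w(f): f \text{ is an IRDF of } G\}$. A distance-hereditary graph is a graph in which the distance between any two vertices in any connected induced subgraph equals their distance in the original graph. Distance-hereditary graphs can be constructed, together with a distinguished vertex subset $TS(G)$ called the twin set, as follows. A single-vertex graph with vertex $v$ has twin set $\{v\}$. From two vertex-disjoint distance-hereditary graphs $G_l,G_r$ with twin sets $TS(G_l),TS(G_r)$, one forms a graph $G$ with $V(G)=V(G_l)\cup V(G_r)$ by one of three operations: true twin, $G=G_l\otimes G_r$: $E(G)=E(G_l)\cup E(G_r)\cup\{v_1v_2: v_1\in TS(G_l), v_2\in TS(G_r)\}$ and $TS(G)=TS(G_l)\cup TS(G_r)$; false twin, $G=G_l\odot G_r$: $E(G)=E(G_l)\cup E(G_r)$ and $TS(G)=TS(G_l)\cup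 TS(G_r)$; attachment, $G=G_l\oplus G_r$: $E(G)=E(G_l)\cup E(G_r)\cup\{v_1v_2: v_1\in TS(G_l), v_2\in TS(G_r)\}$ and $TS(G)=TS(G_l)$. A decomposition tree of $G$ is a full binary tree whose leaves are the vertices of $G$ and whose internal vertices are labelled $\otimes$, $\odot$ or $\oplus$, such that the graph represented by each leaf is the corresponding single-vertex graph, the graph represented by the subtree rooted at an internal vertex is obtained by applying the operation given by its label to the graphs represented by the subtrees rooted at its left child ($G_l$) and right child ($G_r$), and the graph represented by the whole tree is $G$. The quantities computed by the algorithm have the following intended meaning for a distance-hereditary graph $H$ with twin set $TS(H)$: $u^2(H)$ is the minimum weight of an IRDF of $H$ with label $2$ on at least one vertex of $TS(H)$; $u^1(H)$ is the minimum weight of an IRDF of $H$ with label $1$ on at least one vertex of $TS(H)$ and label $2$ on none; $u^0(H)$ is the minimum weight of an IRDF of $H$ with label $0$ on all of $TS(H)$; $u^{00}(H)$ is the minimum weight of a function $V(H)\to\{0,1,2\}$ that is $0$ on $TS(H)$ and whose restriction is an IRDF of the subgraph induced on $V(H)\setminus TS(H)$. *)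

theory Defs
  imports "Graph_Theory.Graph_Theory" "HOL-Library.Extended_Nat"
begin

section \<open>Independent Roman domination\<close>

text \<open>
  A finite simple undirected graph is a \<^term>\<open>pair_graph\<close>: finite, loop-free, with
  a symmetric arc relation.  Labellings are total functions on the vertex type; only their values
  on the vertices of the graph matter.
\<close>

definition IRDF :: "'a pair_pre_digraph \<Rightarrow> ('a \<Rightarrow> nat) \<Rightarrow> bool" where
  "IRDF G f \<longleftrightarrow>
     f ` pverts G \<subseteq> {0, 1, 2} \<and>
     (\<forall>v\<in>pverts G. f v = 0 \<longrightarrow> (\<exists>u\<in>pverts G. (v, u) \<in> parcs G \<and> f u = 2)) \<and>
     (\<forall>u\<in>pverts G. \<forall>v\<in>pverts G. f u \<in> {1, 2} \<and> f v \<in> {1, 2} \<longrightarrow> (u, v) \<notin> parcs G)"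

definition weight :: "'a pair_pre_digraph \<Rightarrow> ('a \<Rightarrow> nat) \<Rightarrow> nat" where
  "weight G f = (\<Sum>v\<in>pverts G. f v)"

definition iR :: "'a pair_pre_digraph \<Rightarrow> nat" where
  "iR G = (LEAST w. \<exists>f. IRDF G f \<and> weight G f = w)"

section \<open>Distance-hereditary graphs and decomposition trees\<close>

definition hop_dist :: "('a, 'b) pre_digraph \<Rightarrow> 'a \<Rightarrow> 'a \<Rightarrow> ereal" where
  "hop_dist H u v = wf_digraph.\<mu> H (\<lambda>_. 1) u v"

definition distance_hereditary :: "'a pair_pre_digraph \<Rightarrow> bool" where
  "distance_hereditary G \<longleftrightarrow>
     (\<forall>S\<subseteq>pverts G. connected (with_proj G \<restriction> S) \<longrightarrow>
        (\<forall>u\<in>S. \<forall>v\<in>S. hop_dist (with_proj G \<restriction> S) u v = hop_dist (with_proj G) u v))"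

datatype twin_op = TrueTwin | FalseTwin | Attachment

datatype 'a dtree = Leaf 'a | Node twin_op "'a dtree" "'a dtree"

fun leaves :: "'a dtree \<Rightarrow> 'a list" where
  "leaves (Leaf v) = [v]"
| "leaves (Node _ l r) = leaves l @ leaves r"

fun twin_set :: "'a dtree \<Rightarrow> 'a set" where
  "twin_set (Leaf v) = {v}"
| "twin_set (Node TrueTwin l r) = twin_set l \<union> twin_set r"
| "twin_set (Node FalseTwin l r) = twin_set l \<union> twin_set r"
| "twin_set (Node Attachment l r) = twin_set l"

definition join_arcs :: "'a set \<Rightarrow> 'a set \<Rightarrow> ('a \<times> 'a) set" where
  "join_arcs A B = A \<times> B \<union> B \<times> A"

fun edges_of :: "'a dtree \<Rightarrow> ('a \<times> 'a) set" where
  "edges_of (Leaf v) = {}"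
| "edges_of (Node TrueTwin l r) =
     edges_of l \<union> edges_of r \<union> join_arcs (twin_set l) (twin_set r)"
| "edges_of (Node FalseTwin l r) = edges_of l \<union> edges_of r"
| "edges_of (Node Attachment l r) =
     edges_of l \<union> edges_of r \<union> join_arcs (twin_set l) (twin_set r)"

definition graph_of :: "'a dtree \<Rightarrow> 'a pair_pre_digraph" where
  "graph_of T = \<lparr>pverts = set (leaves T), parcs = edges_of T\<rparr>"

text \<open>Distinctness of the leaves says that the two graphs combined at each node are disjoint.\<close>

definition decomposition_tree :: "'a dtree \<Rightarrow> 'a pair_pre_digraph \<Rightarrow> bool" where
  "decomposition_tree T G \<longleftrightarrow> distinct (leaves T) \<and> graph_of T = G"

section \<open>A random access machine language with running times\<close>

text \<open>
  Running times refer to the uniform cost measure of a random access machine: every evaluated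
  operator, constant, register, array access, branch and assignment costs one time unit.  Cells
  hold natural numbers or infinity; addition, subtraction, minimum and comparison are the only
  operations.  The finite numbers formed by the algorithm below stay linear in the number of
  vertices, so they fit into words of logarithmic length.
\<close>

datatype reg = Size | Root | First | Last | Count | Cur | Lft | Rgt | Res
datatype arr = Kind | LeftOf | RightOf | Order | U00 | U0 | U1 | U2 | IR

type_synonym state = "(reg \<Rightarrow> enat) \<times> (arr \<Rightarrow> nat \<Rightarrow> enat)"

datatype expr =
    Const enat
  | Reg reg
  | Cell arr expr (infix \<open>\<bullet>\<close> 90)
  | Add expr expr (infixl \<open>[+]\<close> 65)
  | Sub expr expr (infixl \<open>[-]\<close> 65)
  | Minimum expr expr (infixl \<open>[min]\<close> 60)

declare [[coercion Reg]]

datatype test = Less expr expr (infix \<open>[<]\<close> 50) | Eq expr expr (infix \<open>[=]\<close> 50)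

datatype com =
    Assign reg expr (infix \<open>:=\<^sub>r\<close> 45)
  | Store arr expr expr (\<open>_ \<bullet> _ :=\<^sub>a _\<close> [46, 46, 46] 45)
  | Seq com com (infixr \<open>;;\<close> 40)
  | Cond test com com (\<open>(IF _/ THEN _/ ELSE _)\<close> [0, 0, 42] 42)
  | While test com (\<open>(WHILE _/ DO _)\<close> [0, 42] 42)
  | Skip (\<open>SKIP\<close>)

fun eval :: "expr \<Rightarrow> state \<Rightarrow> enat" where
  "eval (Const n) s = n"
| "eval (Reg x) s = fst s x"
| "eval (A \<bullet> e) s = snd s A (the_enat (eval e s))"
| "eval (a [+] b) s = eval a s + eval b s"
| "eval (a [-] b) s = eval a s - eval b s"
| "eval (a [min] b) s = min (eval a s) (eval b s)"

fun expr_cost :: "expr \<Rightarrow> nat" where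
  "expr_cost (Const n) = 1"
| "expr_cost (Reg x) = 1"
| "expr_cost (A \<bullet> e) = 1 + expr_cost e"
| "expr_cost (a [+] b) = 1 + expr_cost a + expr_cost b"
| "expr_cost (a [-] b) = 1 + expr_cost a + expr_cost b"
| "expr_cost (a [min] b) = 1 + expr_cost a + expr_cost b"

fun holds :: "test \<Rightarrow> state \<Rightarrow> bool" where
  "holds (a [<] b) s \<longleftrightarrow> eval a s < eval b s"
| "holds (a [=] b) s \<longleftrightarrow> eval a s = eval b s"

fun test_cost :: "test \<Rightarrow> nat" where
  "test_cost (a [<] b) = 1 + expr_cost a + expr_cost b"
| "test_cost (a [=] b) = 1 + expr_cost a + expr_cost b"

definition set_reg :: "reg \<Rightarrow> enat \<Rightarrow> state \<Rightarrow> state" where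
  "set_reg x n s = ((fst s)(x := n), snd s)"

definition set_cell :: "arr \<Rightarrow> nat \<Rightarrow> enat \<Rightarrow> state \<Rightarrow> state" where
  "set_cell A i n s = (fst s, (snd s)(A := (snd s A)(i := n)))"

text \<open>\<^term>\<open>exec c s t s'\<close>: started in \<open>s\<close>, the program \<open>c\<close> halts in \<open>s'\<close> after
  \<open>t\<close> time units.\<close>

inductive exec :: "com \<Rightarrow> state \<Rightarrow> nat \<Rightarrow> state \<Rightarrow> bool" where
  Skip: "exec SKIP s 1 s"
| Assign: "exec (x :=\<^sub>r e) s (1 + expr_cost e) (set_reg x (eval e s) s)"
| Store: "exec (A \<bullet> i :=\<^sub>a e) s (1 + expr_cost i + expr_cost e)
            (set_cell A (the_enat (eval i s)) (eval e s) s)"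
| Seq: "exec c1 s1 t1 s2 \<Longrightarrow> exec c2 s2 t2 s3 \<Longrightarrow> exec (c1 ;; c2) s1 (t1 + t2) s3"
| IfTrue: "holds b s \<Longrightarrow> exec c1 s t s' \<Longrightarrow> exec (IF b THEN c1 ELSE c2) s (1 + test_cost b + t) s'"
| IfFalse: "\<not> holds b s \<Longrightarrow> exec c2 s t s' \<Longrightarrow> exec (IF b THEN c1 ELSE c2) s (1 + test_cost b + t) s'"
| WhileFalse: "\<not> holds b s \<Longrightarrow> exec (WHILE b DO c) s (1 + test_cost b) s"
| WhileTrue: "holds b s1 \<Longrightarrow> exec c s1 t1 s2 \<Longrightarrow> exec (WHILE b DO c) s2 t2 s3 \<Longrightarrow>
    exec (WHILE b DO c) s1 (1 + test_cost b + t1 + t2) s3"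

inductive_cases SkipE: "exec SKIP s t s'"
inductive_cases AssignE: "exec (x :=\<^sub>r e) s t s'"
inductive_cases StoreE: "exec (A \<bullet> i :=\<^sub>a e) s t s'"
inductive_cases SeqE: "exec (c1 ;; c2) s t s'"
inductive_cases IfE: "exec (IF b THEN c1 ELSE c2) s t s'"
inductive_cases WhileE: "exec (WHILE b DO c) s t s'"

lemma exec_deterministic:
  "exec c s t s' \<Longrightarrow> exec c s t2 s2 \<Longrightarrow> t2 = t \<and> s2 = s'"
proof (induction arbitrary: t2 s2 rule: exec.induct)
  case (Skip s)
  then show ?case by (auto elim: SkipE)
next
  case (Assign x e s)
  then show ?case by (auto elim: AssignE)
next
  case (Store A i e s)
  then show ?case by (auto elim: StoreE)
next
  case (Seq c1 s1 t1 s c2 t2' s3)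
  from Seq.prems obtain u1 r u2 where
    "exec c1 s1 u1 r" "exec c2 r u2 s2" "t2 = u1 + u2" by (auto elim: SeqE)
  with Seq.IH show ?case by metis
next
  case (IfTrue b s c1 t s' c2)
  from IfTrue.prems IfTrue.hyps(1) obtain u where
    "exec c1 s u s2" "t2 = 1 + test_cost b + u" by (auto elim: IfE)
  with IfTrue.IH show ?case by metis
next
  case (IfFalse b s c2 t s' c1)
  from IfFalse.prems IfFalse.hyps(1) obtain u where
    "exec c2 s u s2" "t2 = 1 + test_cost b + u" by (auto elim: IfE)
  with IfFalse.IH show ?case by metis
next
  case (WhileFalse b s c)
  from WhileFalse.prems WhileFalse.hyps show ?case by (auto elim: WhileE)
next
  case (WhileTrue b s1 c t1 s t2' s3)
  from WhileTrue.prems WhileTrue.hyps(1) obtain u1 r u2 where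
    "exec c s1 u1 r" "exec (WHILE b DO c) r u2 s2" "t2 = 1 + test_cost b + u1 + u2"
    by (auto elim: WhileE)
  with WhileTrue.IH show ?case by metis
qed

section \<open>Storing a decomposition tree\<close>

text \<open>
  A tree with \<open>m\<close> nodes is stored as a linked structure on the addresses \<open>0, \<dots>, m - 1\<close>,
  placed in any order.  \<^term>\<open>Kind\<close> holds the label (0 for a leaf), \<^term>\<open>LeftOf\<close> and
  \<^term>\<open>RightOf\<close> the addresses of the children, \<^term>\<open>Root\<close> the address of the root and
  \<^term>\<open>Size\<close> the number \<open>m\<close>.  The algorithm uses \<open>G\<close> only through its tree, and never
  inspects the vertex attached to a leaf, so neither is stored.  All other registers and arrays
  have arbitrary initial contents.
\<close>

fun op_code :: "twin_op \<Rightarrow> enat" where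
  "op_code TrueTwin = 1"
| "op_code FalseTwin = 2"
| "op_code Attachment = 3"

inductive stored_at :: "state \<Rightarrow> nat \<Rightarrow> 'a dtree \<Rightarrow> nat set \<Rightarrow> bool" for s :: state where
  "snd s Kind x = 0 \<Longrightarrow> stored_at s x (Leaf v) {x}"
| "snd s Kind x = op_code p \<Longrightarrow>
   snd s LeftOf x = enat y \<Longrightarrow> stored_at s y l A \<Longrightarrow>
   snd s RightOf x = enat z \<Longrightarrow> stored_at s z r B \<Longrightarrow>
   A \<inter> B = {} \<Longrightarrow> x \<notin> A \<union> B \<Longrightarrow>
   stored_at s x (Node p l r) (insert x (A \<union> B))"

definition stores :: "state \<Rightarrow> 'a dtree \<Rightarrow> bool" where
  "stores s T \<longleftrightarrow>
     (\<exists>x m. fst s Root = enat x \<and> fst s Size = enat m \<and> stored_at s x T {..<m})"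

section \<open>The algorithm\<close>

text \<open>
  \<^term>\<open>Order\<close> serves as the queue of a breadth-first search from the root that enqueues
  internal nodes only; afterwards its entries \<open>1, \<dots>, r\<close> are the BFS ordering and
  \<open>r\<close> is in \<^term>\<open>Last\<close>.
\<close>

definition bfs_ordering :: com where
  "bfs_ordering =
     (Order \<bullet> Const 1 :=\<^sub>a Root ;;
      First :=\<^sub>r Const 1 ;;
      Last :=\<^sub>r Const 1 ;;
      WHILE First [<] Last [+] Const 1 DO
       (Cur :=\<^sub>r Order \<bullet> First ;;
        Lft :=\<^sub>r LeftOf \<bullet> Cur ;;
        Rgt :=\<^sub>r RightOf \<bullet> Cur ;;
        (IF Const 0 [<] Kind \<bullet> Lft
         THEN (Last :=\<^sub>r Last [+] Const 1 ;; Order \<bullet> Last :=\<^sub>a Lft)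
         ELSE SKIP) ;;
        (IF Const 0 [<] Kind \<bullet> Rgt
         THEN (Last :=\<^sub>r Last [+] Const 1 ;; Order \<bullet> Last :=\<^sub>a Rgt)
         ELSE SKIP) ;;
        First :=\<^sub>r First [+] Const 1))"

definition init_leaves :: com where
  "init_leaves =
     (Cur :=\<^sub>r Const 0 ;;
      WHILE Cur [<] Size DO
       ((IF Kind \<bullet> Cur [=] Const 0
         THEN (U00 \<bullet> Cur :=\<^sub>a Const 0 ;;
               U0 \<bullet> Cur :=\<^sub>a Const \<infinity> ;;
               U1 \<bullet> Cur :=\<^sub>a Const 1 ;;
               U2 \<bullet> Cur :=\<^sub>a Const 2 ;;
               IR \<bullet> Cur :=\<^sub>a Const 1)
         ELSE SKIP) ;;
        Cur :=\<^sub>r Cur [+] Const 1))"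

definition true_twin_step :: com where
  "true_twin_step =
     (U2 \<bullet> Cur :=\<^sub>a (U2 \<bullet> Lft [+] U00 \<bullet> Rgt) [min] (U00 \<bullet> Lft [+] U2 \<bullet> Rgt) ;;
      U1 \<bullet> Cur :=\<^sub>a (U1 \<bullet> Lft [+] U0 \<bullet> Rgt) [min] (U0 \<bullet> Lft [+] U1 \<bullet> Rgt) ;;
      U0 \<bullet> Cur :=\<^sub>a U0 \<bullet> Lft [+] U0 \<bullet> Rgt ;;
      U00 \<bullet> Cur :=\<^sub>a U00 \<bullet> Lft [+] U00 \<bullet> Rgt)"

definition false_twin_step :: com where
  "false_twin_step =
     (U2 \<bullet> Cur :=\<^sub>a (U2 \<bullet> Lft [+] IR \<bullet> Rgt) [min] (IR \<bullet> Lft [+] U2 \<bullet> Rgt) ;;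
      U1 \<bullet> Cur :=\<^sub>a (U1 \<bullet> Lft [+] U0 \<bullet> Rgt) [min] (U0 \<bullet> Lft [+] U1 \<bullet> Rgt)
                      [min] (U1 \<bullet> Lft [+] U1 \<bullet> Rgt) ;;
      U0 \<bullet> Cur :=\<^sub>a U0 \<bullet> Lft [+] U0 \<bullet> Rgt ;;
      U00 \<bullet> Cur :=\<^sub>a U00 \<bullet> Lft [+] U00 \<bullet> Rgt)"

definition attachment_step :: com where
  "attachment_step =
     (U2 \<bullet> Cur :=\<^sub>a U2 \<bullet> Lft [+] U00 \<bullet> Rgt ;;
      U1 \<bullet> Cur :=\<^sub>a U1 \<bullet> Lft [+] U0 \<bullet> Rgt ;;
      U0 \<bullet> Cur :=\<^sub>a (U00 \<bullet> Lft [+] U2 \<bullet> Rgt) [min] (U0 \<bullet> Lft [+] U1 \<bullet> Rgt)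
                      [min] (U0 \<bullet> Lft [+] U0 \<bullet> Rgt) ;;
      U00 \<bullet> Cur :=\<^sub>a U00 \<bullet> Lft [+] IR \<bullet> Rgt)"

definition irdn_algorithm :: com where
  "irdn_algorithm =
     (bfs_ordering ;;
      init_leaves ;;
      Count :=\<^sub>r Last ;;
      (WHILE Const 0 [<] Count DO
       (Cur :=\<^sub>r Order \<bullet> Count ;;
        Lft :=\<^sub>r LeftOf \<bullet> Cur ;;
        Rgt :=\<^sub>r RightOf \<bullet> Cur ;;
        (IF Kind \<bullet> Cur [=] Const 1 THEN true_twin_step
         ELSE IF Kind \<bullet> Cur [=] Const 2 THEN false_twin_step
         ELSE attachment_step) ;;
        IR \<bullet> Cur :=\<^sub>a U0 \<bullet> Cur [min] U1 \<bullet> Cur [min] U2 \<bullet> Cur ;;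
        Count :=\<^sub>r Count [-] Const 1)) ;;
      Res :=\<^sub>r IR \<bullet> (Order \<bullet> Const 1))"

end

theory Submission
  imports Defs
begin

text \<open>
  A node of the tree glues its two graphs together along their twin sets only, so all that the rest
  of a labelling has to know about one part is what happens on its twin set.  For an independent
  Roman dominating function (IRDF) of a part there are three possibilities: a twin has label 2,
  some twin has label 1 and none has label 2, or all twins have label 0.  A fourth kind of
  labelling is 0 on the twin set and is an IRDF of the remaining vertices only; it describes a part
  whose twins are dominated from outside.

  The heart of the matter is that, for a \<^emph>\<open>fixed\<close> labelling of the glued graph, membership in one
  of these classes is a disjunction of conjunctions of memberships of its two restrictions.  When
  all arcs between the twin sets are present, a twin with label 2 on one side forces label 0 on all
  twins of the other side and dominates them, so the other part must be of the fourth kind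
  (\<open>IRDF_join_2\<close>).  Without any twin labelled 2, the new arcs dominate nothing and only forbid
  positive labels on both sides (\<open>IRDF_join_no_2\<close>).  The resulting equivalences are
  \<open>twin_TrueTwin\<close>, \<open>twin_FalseTwin\<close>, \<open>twin_Attachment\<close>, \<open>twin00_twins\<close> and
  \<open>twin00_Attachment\<close>.

  Minimum weights turn disjunctions into minima and, because the two parts are disjoint,
  conjunctions of conditions on the two parts into sums (\<open>least_weight_disj\<close>,
  \<open>least_weight_conj\<close>).  This transforms the equivalences into exactly the recurrences of
  the algorithm (\<open>opt_Node\<close>), where an empty class has least weight infinity.

  For the program, every address carries one subtree of the stored tree.  The breadth-first search
  records each internal node at an earlier position than its internal children, so running through
  the positions backwards meets a node when both children are solved (\<open>children_solved\<close>).
  The running time is linear because each pass of a loop has constant cost, the search makes one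
  pass per internal node, and a tree with \<open>n\<close> leaves has \<open>n - 1\<close> internal nodes.
\<close>

section \<open>Independent Roman domination of glued graphs\<close>

abbreviation graph :: "'a set \<Rightarrow> ('a \<times> 'a) set \<Rightarrow> 'a pair_pre_digraph" where
  "graph V E \<equiv> \<lparr>pverts = V, parcs = E\<rparr>"

text \<open>Labels at most 2 and positive labels are easier to reason with than the sets
  \<open>{0, 1, 2}\<close> and \<open>{1, 2}\<close>.\<close>

lemma IRDF_graph:
  "IRDF (graph V E) f \<longleftrightarrow>
     (\<forall>v\<in>V. f v \<le> 2) \<and>
     (\<forall>v\<in>V. f v = 0 \<longrightarrow> (\<exists>u\<in>V. (v, u) \<in> E \<and> f u = 2)) \<and>
     (\<forall>u\<in>V. \<forall>v\<in>V. f u \<noteq> 0 \<longrightarrow> f v \<noteq> 0 \<longrightarrow> (u, v) \<notin> E)"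
proof -
  have "f v \<in> {0, 1, 2} \<longleftrightarrow> f v \<le> 2" for v by auto
  then have lab: "f ` V \<subseteq> {0, 1, 2} \<longleftrightarrow> (\<forall>v\<in>V. f v \<le> 2)" by (simp add: image_subset_iff)
  show ?thesis
  proof (cases "\<forall>v\<in>V. f v \<le> 2")
    case True
    then have nz: "v \<in> V \<Longrightarrow> (f v \<in> {1, 2}) = (f v \<noteq> 0)" for v by force
    then show ?thesis
      unfolding IRDF_def lab pair_pre_digraph.select_convs by (simp only: imp_conjL nz cong: ball_cong)
  qed (simp only: IRDF_def lab pair_pre_digraph.select_convs simp_thms)
qed

lemma IRDF_D:
  assumes "IRDF (graph V E) f"
  shows IRDF_le_2: "v \<in> V \<Longrightarrow> f v \<le> 2"
    and IRDF_dominated: "v \<in> V \<Longrightarrow> f v = 0 \<Longrightarrow> \<exists>u\<in>V. (v, u) \<in> E \<and> f u = 2"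
    and IRDF_independent: "u \<in> V \<Longrightarrow> v \<in> V \<Longrightarrow> f u \<noteq> 0 \<Longrightarrow> f v \<noteq> 0 \<Longrightarrow> (u, v) \<notin> E"
  using assms unfolding IRDF_graph by simp_all

lemma IRDF_I:
  assumes "\<And>v. v \<in> V \<Longrightarrow> f v \<le> 2"
    and "\<And>v. v \<in> V \<Longrightarrow> f v = 0 \<Longrightarrow> \<exists>u\<in>V. (v, u) \<in> E \<and> f u = 2"
    and "\<And>u v. u \<in> V \<Longrightarrow> v \<in> V \<Longrightarrow> f u \<noteq> 0 \<Longrightarrow> f v \<noteq> 0 \<Longrightarrow> (u, v) \<notin> E"
  shows "IRDF (graph V E) f"
  using assms unfolding IRDF_graph by simp

lemma IRDF_cong:
  assumes "\<And>v. v \<in> V \<Longrightarrow> f v = g v"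
    and "\<And>u v. u \<in> V \<Longrightarrow> v \<in> V \<Longrightarrow> (u, v) \<in> E \<longleftrightarrow> (u, v) \<in> E'"
  shows "IRDF (graph V E) f \<longleftrightarrow> IRDF (graph V E') g"
  unfolding IRDF_graph using assms by simp

lemma IRDF_disjoint_union:
  assumes "V \<inter> W = {}" "E \<subseteq> V \<times> V" "F \<subseteq> W \<times> W"
  shows "IRDF (graph (V \<union> W) (E \<union> F)) f \<longleftrightarrow> IRDF (graph V E) f \<and> IRDF (graph W F) f"
proof -
  have "(u, v) \<notin> E \<union> F" "(v, u) \<notin> E \<union> F" if "u \<in> V" "v \<in> W" for u v
    using that assms by auto
  moreover have "(u, v) \<notin> F" "(v, u) \<notin> F" if "u \<in> V" for u v
    using that assms by auto
  moreover have "(u, v) \<notin> E" "(v, u) \<notin> E" if "u \<in> W" for u v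
    using that assms by auto
  ultimately show ?thesis
    unfolding IRDF_graph by (simp add: ball_Un bex_Un) blast
qed

text \<open>The labellings of a part whose vertices in \<open>S\<close> get label 0 and are dominated elsewhere.\<close>

definition IRDF_off :: "'a set \<Rightarrow> 'a set \<Rightarrow> ('a \<times> 'a) set \<Rightarrow> ('a \<Rightarrow> nat) \<Rightarrow> bool" where
  "IRDF_off S V E f \<longleftrightarrow> (\<forall>v\<in>S. f v = 0) \<and> IRDF (graph (V - S) E) f"

lemma join_arcs_commute: "join_arcs A B = join_arcs B A"
  by (auto simp: join_arcs_def)

context
  fixes V W S R :: "'a set" and E F
  assumes disj: "V \<inter> W = {}" and E: "E \<subseteq> V \<times> V" and F: "F \<subseteq> W \<times> W"
    and S: "S \<subseteq> V" and R: "R \<subseteq> W"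
begin

private abbreviation J where "J \<equiv> E \<union> F \<union> join_arcs S R"

private lemma join_arcs_within:
  shows "u \<in> V \<Longrightarrow> v \<in> V \<Longrightarrow> (u, v) \<in> J \<longleftrightarrow> (u, v) \<in> E"
    and "u \<in> W \<Longrightarrow> v \<in> W \<Longrightarrow> (u, v) \<in> J \<longleftrightarrow> (u, v) \<in> F"
  using disj E F R S by (auto simp: join_arcs_def)

private lemma join_arcs_across:
  assumes "u \<in> V" "v \<in> W"
  shows "(u, v) \<in> J \<longleftrightarrow> u \<in> S \<and> v \<in> R" and "(v, u) \<in> J \<longleftrightarrow> u \<in> S \<and> v \<in> R"
  using assms disj E F R S by (auto simp: join_arcs_def)

text \<open>The vertex \<open>s\<close> is adjacent to all of \<open>R\<close>: independence empties \<open>R\<close>, and then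
  \<open>s\<close> dominates \<open>R\<close> while \<open>R\<close> contributes nothing to either part.\<close>

lemma IRDF_join_2:
  assumes s: "s \<in> S" "f s = 2"
  shows "IRDF (graph (V \<union> W) J) f \<longleftrightarrow> IRDF (graph V E) f \<and> IRDF_off R W F f"
proof
  assume L: "IRDF (graph (V \<union> W) J) f"
  have R0: "f v = 0" if "v \<in> R" for v
  proof (rule ccontr)
    assume "f v \<noteq> 0"
    moreover have "(s, v) \<in> J" using s that by (simp add: join_arcs_def)
    ultimately show False using IRDF_independent[OF L, of s v] s that S R by auto
  qed
  have "IRDF (graph V E) f"
  proof (rule IRDF_I)
    fix v assume v: "v \<in> V" "f v = 0"
    then obtain u where u: "u \<in> V \<union> W" "(v, u) \<in> J" "f u = 2"
      using IRDF_dominated[OF L] by blast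
    then have "u \<in> V" using v R0[of u] join_arcs_across(1)[of v u] by auto
    then show "\<exists>u\<in>V. (v, u) \<in> E \<and> f u = 2" using u v join_arcs_within(1) by blast
  qed (use IRDF_le_2[OF L] IRDF_independent[OF L] in auto)
  moreover have "IRDF (graph (W - R) F) f"
  proof (rule IRDF_I)
    fix v assume v: "v \<in> W - R" "f v = 0"
    then obtain u where u: "u \<in> V \<union> W" "(v, u) \<in> J" "f u = 2"
      using IRDF_dominated[OF L, of v] by blast
    then have "u \<in> W - R" using v R0[of u] join_arcs_across(2)[of u v] by auto
    then show "\<exists>u\<in>W - R. (v, u) \<in> F \<and> f u = 2" using u v join_arcs_within(2) by blast
  qed (use IRDF_le_2[OF L] IRDF_independent[OF L] in auto)
  ultimately show "IRDF (graph V E) f \<and> IRDF_off R W F f" by (simp add: IRDF_off_def R0)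
next
  assume "IRDF (graph V E) f \<and> IRDF_off R W F f"
  then have V: "IRDF (graph V E) f" and W: "IRDF (graph (W - R) F) f" and R0: "\<And>v. v \<in> R \<Longrightarrow> f v = 0"
    by (auto simp: IRDF_off_def)
  show "IRDF (graph (V \<union> W) J) f"
  proof (rule IRDF_I)
    fix v assume v: "v \<in> V \<union> W"
    then consider "v \<in> V" | "v \<in> W - R" | "v \<in> R" by auto
    then show "f v \<le> 2" using IRDF_le_2[OF V] IRDF_le_2[OF W] R0 by cases auto
  next
    fix v assume v: "v \<in> V \<union> W" "f v = 0"
    then consider "v \<in> V" | "v \<in> W - R" | "v \<in> R" by auto
    then show "\<exists>u\<in>V \<union> W. (v, u) \<in> J \<and> f u = 2"
    proof cases
      case 1 then show ?thesis using IRDF_dominated[OF V] v by blast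
    next
      case 2 then show ?thesis using IRDF_dominated[OF W] v by blast
    next
      case 3 then show ?thesis using s S by (intro bexI[of _ s]) (auto simp: join_arcs_def)
    qed
  next
    fix u v assume uv: "u \<in> V \<union> W" "v \<in> V \<union> W" "f u \<noteq> 0" "f v \<noteq> 0"
    then have "u \<notin> R" "v \<notin> R" using R0 by auto
    then show "(u, v) \<notin> J"
      using IRDF_independent[OF V, of u v] IRDF_independent[OF W, of u v] uv disj E F
      by (auto simp: join_arcs_def)
  qed
qed

text \<open>Arcs between vertices that do not have label 2 dominate nothing; what remains of them is the
  independence condition.\<close>

lemma IRDF_join_no_2:
  assumes "\<forall>v\<in>S. f v \<noteq> 2" "\<forall>v\<in>R. f v \<noteq> 2"
  shows "IRDF (graph (V \<union> W) J) f \<longleftrightarrow>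
    IRDF (graph V E) f \<and> IRDF (graph W F) f \<and> ((\<forall>v\<in>S. f v = 0) \<or> (\<forall>v\<in>R. f v = 0))"
proof -
  let ?U = "V \<union> W"
  have dom: "(\<exists>u\<in>?U. (v, u) \<in> J \<and> f u = 2) \<longleftrightarrow> (\<exists>u\<in>?U. (v, u) \<in> E \<union> F \<and> f u = 2)" for v
    using assms by (auto simp: join_arcs_def)
  have ind: "(\<forall>u\<in>?U. \<forall>v\<in>?U. P u \<longrightarrow> P v \<longrightarrow> (u, v) \<notin> J) \<longleftrightarrow>
      (\<forall>u\<in>?U. \<forall>v\<in>?U. P u \<longrightarrow> P v \<longrightarrow> (u, v) \<notin> E \<union> F) \<and>
      ((\<forall>v\<in>S. \<not> P v) \<or> (\<forall>v\<in>R. \<not> P v))" for P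
    using S R unfolding join_arcs_def by blast
  have "IRDF (graph ?U J) f \<longleftrightarrow>
      IRDF (graph ?U (E \<union> F)) f \<and> ((\<forall>v\<in>S. f v = 0) \<or> (\<forall>v\<in>R. f v = 0))"
    unfolding IRDF_graph dom ind by simp
  then show ?thesis using IRDF_disjoint_union[OF disj E F] by blast
qed

end

section \<open>Labellings classified by their twin set\<close>

lemma twin_set_subset: "twin_set T \<subseteq> set (leaves T)"
  by (induction T rule: twin_set.induct) auto

lemma edges_of_subset: "edges_of T \<subseteq> set (leaves T) \<times> set (leaves T)"
proof (induction T rule: edges_of.induct)
  case (2 l r) then show ?case using twin_set_subset[of l] twin_set_subset[of r] by (auto simp: join_arcs_def)
next
  case (4 l r) then show ?case using twin_set_subset[of l] twin_set_subset[of r] by (auto simp: join_arcs_def)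
qed auto

definition irdf :: "'a dtree \<Rightarrow> ('a \<Rightarrow> nat) \<Rightarrow> bool" where
  "irdf T f \<longleftrightarrow> IRDF (graph_of T) f"

text \<open>The labellings behind the quantities \<open>u\<^sup>2\<close>, \<open>u\<^sup>1\<close>, \<open>u\<^sup>0\<close> and
  \<open>u\<^sup>0\<^sup>0\<close>; \<^term>\<open>irdf\<close> belongs to the domination number itself.\<close>

definition twin2 :: "'a dtree \<Rightarrow> ('a \<Rightarrow> nat) \<Rightarrow> bool" where
  "twin2 T f \<longleftrightarrow> irdf T f \<and> (\<exists>v\<in>twin_set T. f v = 2)"

definition twin1 :: "'a dtree \<Rightarrow> ('a \<Rightarrow> nat) \<Rightarrow> bool" where
  "twin1 T f \<longleftrightarrow> irdf T f \<and> (\<exists>v\<in>twin_set T. f v = 1) \<and> (\<forall>v\<in>twin_set T. f v \<noteq> 2)"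

definition twin0 :: "'a dtree \<Rightarrow> ('a \<Rightarrow> nat) \<Rightarrow> bool" where
  "twin0 T f \<longleftrightarrow> irdf T f \<and> (\<forall>v\<in>twin_set T. f v = 0)"

definition twin00 :: "'a dtree \<Rightarrow> ('a \<Rightarrow> nat) \<Rightarrow> bool" where
  "twin00 T f \<longleftrightarrow> IRDF_off (twin_set T) (set (leaves T)) (edges_of T) f"

lemmas twin_defs = twin2_def twin1_def twin0_def

lemma irdf_cases: "irdf T f \<longleftrightarrow> twin0 T f \<or> twin1 T f \<or> twin2 T f"
proof -
  have "f v = 0 \<or> f v = 1 \<or> f v = 2" if "irdf T f" "v \<in> twin_set T" for v
    using IRDF_le_2[of "set (leaves T)" "edges_of T" f v] that twin_set_subset[of T]
    by (auto simp: irdf_def graph_of_def)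
  then show ?thesis unfolding twin_defs by blast
qed

lemma twin00_zero: "twin00 T f \<Longrightarrow> v \<in> twin_set T \<Longrightarrow> f v = 0"
  by (simp add: twin00_def IRDF_off_def)

text \<open>Treating \<open>twin_labels T f 1\<close> and \<open>twin_labels T f 2\<close> as atoms makes the case
  distinctions below purely propositional.\<close>

definition twin_labels :: "'a dtree \<Rightarrow> ('a \<Rightarrow> nat) \<Rightarrow> nat \<Rightarrow> bool" where
  "twin_labels T f k \<longleftrightarrow> (\<exists>v\<in>twin_set T. f v = k)"

lemma twin2_iff: "twin2 T f \<longleftrightarrow> irdf T f \<and> twin_labels T f 2"
  and twin1_iff: "twin1 T f \<longleftrightarrow> irdf T f \<and> twin_labels T f 1 \<and> \<not> twin_labels T f 2"
  by (auto simp: twin_defs twin_labels_def)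

lemma twin0_iff: "twin0 T f \<longleftrightarrow> irdf T f \<and> \<not> twin_labels T f 1 \<and> \<not> twin_labels T f 2"
  using irdf_cases[of T f] by (auto simp: twin_defs twin_labels_def)

lemma twin_labels:
  "twin2 T f \<Longrightarrow> twin_labels T f 2"
  "twin1 T f \<Longrightarrow> twin_labels T f 1" "twin1 T f \<Longrightarrow> \<not> twin_labels T f 2"
  "twin0 T f \<Longrightarrow> \<not> twin_labels T f 1" "twin0 T f \<Longrightarrow> \<not> twin_labels T f 2"
  "twin00 T f \<Longrightarrow> \<not> twin_labels T f 1" "twin00 T f \<Longrightarrow> \<not> twin_labels T f 2"
  using twin00_zero[of T f] by (auto simp: twin_defs twin_labels_def)

context
  fixes l r :: "'a dtree"
  assumes disj: "set (leaves l) \<inter> set (leaves r) = {}"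
begin

private lemmas parts = disj edges_of_subset edges_of_subset twin_set_subset twin_set_subset

private lemma disj': "set (leaves r) \<inter> set (leaves l) = {}" using disj by auto
private lemmas parts' = disj' edges_of_subset edges_of_subset twin_set_subset twin_set_subset

text \<open>The master equivalence for the two operations that add arcs.  Its five disjuncts list which
  side has a twin labelled 2, which side has a twin labelled 1 (the other side must then be 0 on its
  twins, without being dominated across), and the case of no positive twin.\<close>

lemma irdf_join:
  assumes "p \<noteq> FalseTwin"
  shows "irdf (Node p l r) f \<longleftrightarrow>
    twin2 l f \<and> twin00 r f \<or> twin00 l f \<and> twin2 r f \<or>
    twin1 l f \<and> twin0 r f \<or> twin0 l f \<and> twin1 r f \<or> twin0 l f \<and> twin0 r f"
proof -
  have J: "irdf (Node p l r) f \<longleftrightarrow> IRDF (graph (set (leaves l) \<union> set (leaves r))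
      (edges_of l \<union> edges_of r \<union> join_arcs (twin_set l) (twin_set r))) f"
    using assms by (cases p) (auto simp: irdf_def graph_of_def)
  have 1: "irdf (Node p l r) f \<longleftrightarrow> irdf l f \<and> twin00 r f" if "v \<in> twin_set l" "f v = 2" for v
    unfolding J unfolding irdf_def twin00_def graph_of_def
    by (rule IRDF_join_2[OF parts]) (use that in auto)
  have 2: "irdf (Node p l r) f \<longleftrightarrow> irdf r f \<and> twin00 l f" if "v \<in> twin_set r" "f v = 2" for v
    unfolding J unfolding irdf_def twin00_def graph_of_def
    using IRDF_join_2[OF parts', of v f] that by (simp add: Un_commute join_arcs_commute)
  have 3: "irdf (Node p l r) f \<longleftrightarrow>
     irdf l f \<and> irdf r f \<and> ((\<forall>v\<in>twin_set l. f v = 0) \<or> (\<forall>v\<in>twin_set r. f v = 0))"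
     if "\<forall>v\<in>twin_set l. f v \<noteq> 2" "\<forall>v\<in>twin_set r. f v \<noteq> 2"
    unfolding J unfolding irdf_def graph_of_def by (rule IRDF_join_no_2[OF parts]) (use that in auto)
  consider (l) v where "v \<in> twin_set l" "f v = 2" | (r) v where "v \<in> twin_set r" "f v = 2"
    | (n) "\<forall>v\<in>twin_set l. f v \<noteq> 2" "\<forall>v\<in>twin_set r. f v \<noteq> 2" by blast
  then show ?thesis
  proof cases
    case l
    then have "twin_labels l f 2" by (auto simp: twin_labels_def)
    then show ?thesis using 1[OF l] twin_labels[of l f] twin2_iff[of l f] by blast
  next
    case r
    then have "twin_labels r f 2" by (auto simp: twin_labels_def)
    then show ?thesis using 2[OF r] twin_labels[of r f] twin2_iff[of r f] by blast
  next
    case n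
    then have "\<not> twin2 l f" "\<not> twin2 r f" unfolding twin_defs by auto
    then show ?thesis using 3[OF n] irdf_cases[of l f] irdf_cases[of r f]
      unfolding twin0_def by blast
  qed
qed

lemma irdf_FalseTwin: "irdf (Node FalseTwin l r) f \<longleftrightarrow> irdf l f \<and> irdf r f"
  using IRDF_disjoint_union[OF disj edges_of_subset edges_of_subset]
  by (simp add: irdf_def graph_of_def)

lemma twin_TrueTwin:
  shows "twin2 (Node TrueTwin l r) f \<longleftrightarrow> twin2 l f \<and> twin00 r f \<or> twin00 l f \<and> twin2 r f"
    and "twin1 (Node TrueTwin l r) f \<longleftrightarrow> twin1 l f \<and> twin0 r f \<or> twin0 l f \<and> twin1 r f"
    and "twin0 (Node TrueTwin l r) f \<longleftrightarrow> twin0 l f \<and> twin0 r f"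
proof -
  let ?N = "Node TrueTwin l r"
  have join: "twin_labels ?N f k \<longleftrightarrow> twin_labels l f k \<or> twin_labels r f k" for k
    by (auto simp: twin_labels_def)
  note labels = twin_labels[of l f] twin_labels[of r f] and iffs = irdf_join[of TrueTwin f, simplified] join
  show "twin2 ?N f \<longleftrightarrow> twin2 l f \<and> twin00 r f \<or> twin00 l f \<and> twin2 r f"
    unfolding twin2_iff[of ?N f] iffs using labels by blast
  show "twin1 ?N f \<longleftrightarrow> twin1 l f \<and> twin0 r f \<or> twin0 l f \<and> twin1 r f"
    unfolding twin1_iff[of ?N f] iffs using labels by blast
  show "twin0 ?N f \<longleftrightarrow> twin0 l f \<and> twin0 r f"
    unfolding twin0_iff[of ?N f] iffs using labels by blast
qed

lemma twin_FalseTwin: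
  shows "twin2 (Node FalseTwin l r) f \<longleftrightarrow> twin2 l f \<and> irdf r f \<or> irdf l f \<and> twin2 r f"
    and "twin1 (Node FalseTwin l r) f \<longleftrightarrow>
      twin1 l f \<and> twin0 r f \<or> twin0 l f \<and> twin1 r f \<or> twin1 l f \<and> twin1 r f"
    and "twin0 (Node FalseTwin l r) f \<longleftrightarrow> twin0 l f \<and> twin0 r f"
proof -
  let ?N = "Node FalseTwin l r"
  have join: "twin_labels ?N f k \<longleftrightarrow> twin_labels l f k \<or> twin_labels r f k" for k
    by (auto simp: twin_labels_def)
  note iffs = twin2_iff twin1_iff twin0_iff irdf_FalseTwin join
  show "twin2 ?N f \<longleftrightarrow> twin2 l f \<and> irdf r f \<or> irdf l f \<and> twin2 r f"
    unfolding iffs by blast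
  show "twin1 ?N f \<longleftrightarrow> twin1 l f \<and> twin0 r f \<or> twin0 l f \<and> twin1 r f \<or> twin1 l f \<and> twin1 r f"
    unfolding iffs by blast
  show "twin0 ?N f \<longleftrightarrow> twin0 l f \<and> twin0 r f"
    unfolding iffs by blast
qed

lemma twin_Attachment:
  shows "twin2 (Node Attachment l r) f \<longleftrightarrow> twin2 l f \<and> twin00 r f"
    and "twin1 (Node Attachment l r) f \<longleftrightarrow> twin1 l f \<and> twin0 r f"
    and "twin0 (Node Attachment l r) f \<longleftrightarrow>
      twin00 l f \<and> twin2 r f \<or> twin0 l f \<and> twin1 r f \<or> twin0 l f \<and> twin0 r f"
proof -
  let ?N = "Node Attachment l r"
  have left: "twin_labels ?N f k \<longleftrightarrow> twin_labels l f k" for k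
    by (auto simp: twin_labels_def)
  note labels = twin_labels[of l f] twin_labels[of r f] and iffs = irdf_join[of Attachment f, simplified] left
  show "twin2 ?N f \<longleftrightarrow> twin2 l f \<and> twin00 r f"
    unfolding twin2_iff[of ?N f] iffs using labels by blast
  show "twin1 ?N f \<longleftrightarrow> twin1 l f \<and> twin0 r f"
    unfolding twin1_iff[of ?N f] iffs using labels by blast
  show "twin0 ?N f \<longleftrightarrow>
      twin00 l f \<and> twin2 r f \<or> twin0 l f \<and> twin1 r f \<or> twin0 l f \<and> twin0 r f"
    unfolding twin0_iff[of ?N f] iffs using labels by blast
qed

text \<open>Removing the twin sets removes every arc between the two parts.\<close>

lemma twin00_twins:
  assumes "p \<noteq> Attachment"
  shows "twin00 (Node p l r) f \<longleftrightarrow> twin00 l f \<and> twin00 r f"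
proof -
  let ?V = "set (leaves l) - twin_set l" and ?W = "set (leaves r) - twin_set r"
  let ?E = "edges_of l \<inter> ?V \<times> ?V" and ?F = "edges_of r \<inter> ?W \<times> ?W"
  have V: "set (leaves (Node p l r)) - twin_set (Node p l r) = ?V \<union> ?W"
    using assms disj twin_set_subset[of l] twin_set_subset[of r] by (cases p) auto
  have "IRDF (graph (?V \<union> ?W) (edges_of (Node p l r))) f \<longleftrightarrow> IRDF (graph (?V \<union> ?W) (?E \<union> ?F)) f"
  proof (rule IRDF_cong)
    fix u v assume "u \<in> ?V \<union> ?W" "v \<in> ?V \<union> ?W"
    then show "(u, v) \<in> edges_of (Node p l r) \<longleftrightarrow> (u, v) \<in> ?E \<union> ?F"
      using assms disj edges_of_subset[of l] edges_of_subset[of r]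
        twin_set_subset[of l] twin_set_subset[of r]
      by (cases p) (auto simp: join_arcs_def)
  qed simp
  also have "\<dots> \<longleftrightarrow> IRDF (graph ?V ?E) f \<and> IRDF (graph ?W ?F) f"
    using disj by (intro IRDF_disjoint_union) auto
  also have "IRDF (graph ?V ?E) f \<longleftrightarrow> IRDF (graph ?V (edges_of l)) f" by (rule IRDF_cong) auto
  also have "IRDF (graph ?W ?F) f \<longleftrightarrow> IRDF (graph ?W (edges_of r)) f" by (rule IRDF_cong) auto
  finally show ?thesis
    using assms unfolding twin00_def IRDF_off_def V by (cases p) auto
qed

text \<open>The twins of the right part are not twins of the whole, so the right part stays complete; its
  arcs to the left part vanish with the left twin set.\<close>

lemma twin00_Attachment: "twin00 (Node Attachment l r) f \<longleftrightarrow> twin00 l f \<and> irdf r f"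
proof -
  let ?V = "set (leaves l) - twin_set l" and ?W = "set (leaves r)"
  let ?E = "edges_of l \<inter> ?V \<times> ?V"
  have V: "set (leaves (Node Attachment l r)) - twin_set (Node Attachment l r) = ?V \<union> ?W"
    using disj twin_set_subset[of l] by auto
  have "IRDF (graph (?V \<union> ?W) (edges_of (Node Attachment l r))) f \<longleftrightarrow>
      IRDF (graph (?V \<union> ?W) (?E \<union> edges_of r)) f"
    using disj edges_of_subset[of l] edges_of_subset[of r] twin_set_subset[of l]
    by (intro IRDF_cong) (auto simp: join_arcs_def)
  also have "\<dots> \<longleftrightarrow> IRDF (graph ?V ?E) f \<and> irdf r f"
    unfolding irdf_def graph_of_def using disj edges_of_subset[of r]
    by (intro IRDF_disjoint_union) auto
  also have "IRDF (graph ?V ?E) f \<longleftrightarrow> IRDF (graph ?V (edges_of l)) f" by (rule IRDF_cong) auto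
  finally show ?thesis unfolding twin00_def IRDF_off_def V by auto
qed

end

section \<open>Least weights and the recurrences\<close>

text \<open>Infinity if no labelling satisfies the condition.\<close>

definition least_weight :: "'a set \<Rightarrow> (('a \<Rightarrow> nat) \<Rightarrow> bool) \<Rightarrow> enat" where
  "least_weight V P = (INF f\<in>Collect P. enat (sum f V))"

lemma least_weight_disj: "least_weight V (\<lambda>f. P f \<or> Q f) = min (least_weight V P) (least_weight V Q)"
  unfolding least_weight_def Collect_disj_eq INF_union inf_min ..

lemma least_weight_attained:
  assumes "least_weight V P \<noteq> \<infinity>"
  obtains f where "P f" "least_weight V P = enat (sum f V)"
proof -
  have ne: "(\<lambda>f. enat (sum f V)) ` Collect P \<noteq> {}"
  proof
    assume "(\<lambda>f. enat (sum f V)) ` Collect P = {}"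
    then show False using assms unfolding least_weight_def by (simp only: Inf_empty top_enat_def)
  qed
  then have "Inf ((\<lambda>f. enat (sum f V)) ` Collect P) \<in> (\<lambda>f. enat (sum f V)) ` Collect P"
    unfolding Inf_enat_def by (auto intro: LeastI)
  then show thesis using that unfolding least_weight_def by auto
qed

lemma least_weight_le: "P f \<Longrightarrow> least_weight V P \<le> enat (sum f V)"
  unfolding least_weight_def by (rule INF_lower) simp

text \<open>Each condition looks at one of two disjoint vertex sets only, so optimal labellings of the
  two sets can be pasted together.\<close>

lemma least_weight_conj:
  assumes fin: "finite V" "finite W" and disj: "V \<inter> W = {}"
    and P: "\<And>f g. (\<And>v. v \<in> V \<Longrightarrow> f v = g v) \<Longrightarrow> P f \<longleftrightarrow> P g"
    and Q: "\<And>f g. (\<And>v. v \<in> W \<Longrightarrow> f v = g v) \<Longrightarrow> Q f \<longleftrightarrow> Q g"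
  shows "least_weight (V \<union> W) (\<lambda>f. P f \<and> Q f) = least_weight V P + least_weight W Q"
proof (rule antisym)
  show "least_weight V P + least_weight W Q \<le> least_weight (V \<union> W) (\<lambda>f. P f \<and> Q f)"
    unfolding least_weight_def[of "V \<union> W"]
  proof (rule INF_greatest, clarsimp)
    fix f assume "P f" "Q f"
    then have "least_weight V P + least_weight W Q \<le> enat (sum f V) + enat (sum f W)"
      by (intro add_mono least_weight_le)
    then show "least_weight V P + least_weight W Q \<le> enat (sum f (V \<union> W))"
      by (simp add: sum.union_disjoint fin disj)
  qed
  show "least_weight (V \<union> W) (\<lambda>f. P f \<and> Q f) \<le> least_weight V P + least_weight W Q"
  proof (cases "least_weight V P = \<infinity> \<or> least_weight W Q = \<infinity>")
    case False
    then obtain f g where f: "P f" "least_weight V P = enat (sum f V)"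
      and g: "Q g" "least_weight W Q = enat (sum g W)"
      by (metis least_weight_attained)
    define h where "h v = (if v \<in> V then f v else g v)" for v
    have hV: "h v = f v" if "v \<in> V" for v using that by (simp add: h_def)
    have hW: "h v = g v" if "v \<in> W" for v using that disj by (auto simp: h_def)
    have "P h" "Q h" using f(1) g(1) P[OF hV] Q[OF hW] by auto
    then have "least_weight (V \<union> W) (\<lambda>f. P f \<and> Q f) \<le> enat (sum h (V \<union> W))"
      by (intro least_weight_le) simp
    also have "sum h (V \<union> W) = sum f V + sum g W"
      by (simp add: sum.union_disjoint fin disj hV hW)
    finally show ?thesis by (simp add: f g)
  qed auto
qed

definition opt :: "('a dtree \<Rightarrow> ('a \<Rightarrow> nat) \<Rightarrow> bool) \<Rightarrow> 'a dtree \<Rightarrow> enat" where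
  "opt F T = least_weight (set (leaves T)) (F T)"

definition leaf_local :: "('a dtree \<Rightarrow> ('a \<Rightarrow> nat) \<Rightarrow> bool) \<Rightarrow> bool" where
  "leaf_local F \<longleftrightarrow> (\<forall>T f g. (\<forall>v\<in>set (leaves T). f v = g v) \<longrightarrow> F T f = F T g)"

lemma feasibility_cong:
  fixes f g :: "'a \<Rightarrow> nat"
  assumes fg: "\<forall>v\<in>set (leaves T). f v = g v"
  shows irdf_cong: "irdf T f = irdf T g" and twin2_cong: "twin2 T f = twin2 T g"
    and twin1_cong: "twin1 T f = twin1 T g" and twin0_cong: "twin0 T f = twin0 T g"
    and twin00_cong: "twin00 T f = twin00 T g"
proof -
  have ts: "\<forall>v\<in>twin_set T. f v = g v" using fg twin_set_subset[of T] by auto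
  show I: "irdf T f = irdf T g"
    unfolding irdf_def graph_of_def using fg by (intro IRDF_cong) auto
  show "twin2 T f = twin2 T g" "twin1 T f = twin1 T g" "twin0 T f = twin0 T g"
    unfolding twin_defs I using ts by simp_all
  have "IRDF (graph (set (leaves T) - twin_set T) (edges_of T)) f \<longleftrightarrow>
      IRDF (graph (set (leaves T) - twin_set T) (edges_of T)) g"
    using fg by (intro IRDF_cong) auto
  then show "twin00 T f = twin00 T g"
    unfolding twin00_def IRDF_off_def using ts by simp
qed

lemma leaf_local_feasibility: "leaf_local irdf" "leaf_local twin2" "leaf_local twin1" "leaf_local twin0" "leaf_local twin00"
  unfolding leaf_local_def using feasibility_cong by blast+

lemma opt_conj:
  assumes "set (leaves l) \<inter> set (leaves r) = {}" "leaf_local F" "leaf_local F'"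
  shows "least_weight (set (leaves l) \<union> set (leaves r)) (\<lambda>f. F l f \<and> F' r f) = opt F l + opt F' r"
  unfolding opt_def using assms
  by (intro least_weight_conj) (auto simp: leaf_local_def)

lemma opt_Leaf:
  "opt twin00 (Leaf v) = 0" "opt twin0 (Leaf v) = \<infinity>" "opt twin1 (Leaf v) = 1"
  "opt twin2 (Leaf v) = 2" "opt irdf (Leaf v) = 1"
proof -
  have I: "irdf (Leaf v) f \<longleftrightarrow> f v = 1 \<or> f v = 2" for f
    by (auto simp: irdf_def IRDF_def graph_of_def)
  have eq: "opt F (Leaf v) = enat (f v)" if "F (Leaf v) f" "\<And>g. F (Leaf v) g \<Longrightarrow> f v \<le> g v"
    for F and f :: "'a \<Rightarrow> nat"
  proof (rule antisym)
    show "opt F (Leaf v) \<le> enat (f v)"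
      using least_weight_le[of "F (Leaf v)" f "{v}"] that by (simp add: opt_def)
    show "enat (f v) \<le> opt F (Leaf v)"
      unfolding opt_def least_weight_def by (rule INF_greatest) (use that in auto)
  qed
  have "Collect (twin0 (Leaf v)) = {}" by (auto simp: twin0_def I)
  then show "opt twin0 (Leaf v) = \<infinity>"
    unfolding opt_def least_weight_def by (simp only: image_empty Inf_empty top_enat_def)
  have "opt twin00 (Leaf v) = enat ((\<lambda>_. 0) v)"
    by (rule eq) (auto simp: twin00_def IRDF_off_def IRDF_def)
  moreover have "opt twin1 (Leaf v) = enat ((\<lambda>_. 1) v)"
    by (rule eq) (auto simp: twin1_def I)
  moreover have "opt twin2 (Leaf v) = enat ((\<lambda>_. 2) v)"
    by (rule eq) (auto simp: twin2_def I)
  moreover have "opt irdf (Leaf v) = enat ((\<lambda>_. 1) v)"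
    by (rule eq) (auto simp: I)
  ultimately show "opt twin00 (Leaf v) = 0" "opt twin1 (Leaf v) = 1" "opt twin2 (Leaf v) = 2"
    "opt irdf (Leaf v) = 1"
    by (simp_all add: zero_enat_def one_enat_def numeral_eq_enat)
qed

lemma opt_irdf: "opt irdf T = min (opt twin0 T) (min (opt twin1 T) (opt twin2 T))"
proof -
  have "irdf T = (\<lambda>f. twin0 T f \<or> twin1 T f \<or> twin2 T f)" by (auto simp: irdf_cases)
  then show ?thesis unfolding opt_def by (simp add: least_weight_disj)
qed

lemma opt_Node:
  assumes disj: "set (leaves l) \<inter> set (leaves r) = {}"
  shows opt_TrueTwin:
      "opt twin2 (Node TrueTwin l r) =
        min (opt twin2 l + opt twin00 r) (opt twin00 l + opt twin2 r)"
      "opt twin1 (Node TrueTwin l r) =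
        min (opt twin1 l + opt twin0 r) (opt twin0 l + opt twin1 r)"
      "opt twin0 (Node TrueTwin l r) = opt twin0 l + opt twin0 r"
      "opt twin00 (Node TrueTwin l r) = opt twin00 l + opt twin00 r"
    and opt_FalseTwin:
      "opt twin2 (Node FalseTwin l r) =
        min (opt twin2 l + opt irdf r) (opt irdf l + opt twin2 r)"
      "opt twin1 (Node FalseTwin l r) =
        min (min (opt twin1 l + opt twin0 r) (opt twin0 l + opt twin1 r)) (opt twin1 l + opt twin1 r)"
      "opt twin0 (Node FalseTwin l r) = opt twin0 l + opt twin0 r"
      "opt twin00 (Node FalseTwin l r) = opt twin00 l + opt twin00 r"
    and opt_Attachment:
      "opt twin2 (Node Attachment l r) = opt twin2 l + opt twin00 r"
      "opt twin1 (Node Attachment l r) = opt twin1 l + opt twin0 r"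
      "opt twin0 (Node Attachment l r) =
        min (min (opt twin00 l + opt twin2 r) (opt twin0 l + opt twin1 r)) (opt twin0 l + opt twin0 r)"
      "opt twin00 (Node Attachment l r) = opt twin00 l + opt irdf r"
proof -
  note rules = opt_def[of _ "Node p l r" for p] least_weight_disj opt_conj[OF disj]
    leaf_local_feasibility min.assoc
    twin_TrueTwin[OF disj, abs_def] twin_FalseTwin[OF disj, abs_def]
    twin_Attachment[OF disj, abs_def]
    twin00_twins[OF disj, of TrueTwin, simplified, abs_def]
    twin00_twins[OF disj, of FalseTwin, simplified, abs_def] twin00_Attachment[OF disj, abs_def]
  show 
      "opt twin2 (Node TrueTwin l r) =
        min (opt twin2 l + opt twin00 r) (opt twin00 l + opt twin2 r)"
      "opt twin1 (Node TrueTwin l r) =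
        min (opt twin1 l + opt twin0 r) (opt twin0 l + opt twin1 r)"
      "opt twin0 (Node TrueTwin l r) = opt twin0 l + opt twin0 r"
      "opt twin00 (Node TrueTwin l r) = opt twin00 l + opt twin00 r"
      "opt twin2 (Node FalseTwin l r) =
        min (opt twin2 l + opt irdf r) (opt irdf l + opt twin2 r)"
      "opt twin1 (Node FalseTwin l r) =
        min (min (opt twin1 l + opt twin0 r) (opt twin0 l + opt twin1 r)) (opt twin1 l + opt twin1 r)"
      "opt twin0 (Node FalseTwin l r) = opt twin0 l + opt twin0 r"
      "opt twin00 (Node FalseTwin l r) = opt twin00 l + opt twin00 r"
      "opt twin2 (Node Attachment l r) = opt twin2 l + opt twin00 r"
      "opt twin1 (Node Attachment l r) = opt twin1 l + opt twin0 r"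
      "opt twin0 (Node Attachment l r) =
        min (min (opt twin00 l + opt twin2 r) (opt twin0 l + opt twin1 r)) (opt twin0 l + opt twin0 r)"
      "opt twin00 (Node Attachment l r) = opt twin00 l + opt irdf r"
    by (simp_all add: rules)
qed

lemma opt_irdf_finite: "opt twin2 T \<noteq> \<infinity> \<Longrightarrow> opt irdf T \<noteq> \<infinity>"
  unfolding opt_irdf by (metis enat_ord_simps(5) min.cobounded2 min.coboundedI2)

text \<open>Of the four quantities only these two are always finite; together they keep
  each other finite through the recurrences, and \<open>u\<^sup>2\<close> bounds the domination number.\<close>

lemma opt_finite:
  assumes "distinct (leaves T)"
  shows "opt twin2 T \<noteq> \<infinity> \<and> opt twin00 T \<noteq> \<infinity>"
  using assms
proof (induction T)
  case (Node p l r)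
  then have "opt irdf l \<noteq> \<infinity>" "opt irdf r \<noteq> \<infinity>" using opt_irdf_finite[of l] opt_irdf_finite[of r] by auto
  with Node show ?case by (cases p) (simp_all add: opt_Node min_def plus_eq_infty_iff_enat del: not_infinity_eq)
qed (simp add: opt_Leaf)

text \<open>Finiteness guarantees that the set of weights behind \<^term>\<open>iR\<close> is nonempty, so that its
  least element is meaningful.\<close>

lemma opt_irdf_eq_iR:
  assumes "distinct (leaves T)"
  shows "opt irdf T = enat (iR (graph_of T))"
proof -
  have "opt irdf T \<noteq> \<infinity>" using opt_finite[OF assms] opt_irdf_finite by blast
  then obtain f where f: "irdf T f" "opt irdf T = enat (sum f (set (leaves T)))"
    unfolding opt_def by (metis least_weight_attained)
  have "iR (graph_of T) = sum f (set (leaves T))" unfolding iR_def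
  proof (rule Least_equality)
    show "\<exists>g. IRDF (graph_of T) g \<and> weight (graph_of T) g = sum f (set (leaves T))"
      using f(1) by (auto simp: irdf_def weight_def graph_of_def)
    fix w assume "\<exists>g. IRDF (graph_of T) g \<and> weight (graph_of T) g = w"
    then obtain g where "irdf T g" "w = sum g (set (leaves T))"
      by (auto simp: irdf_def weight_def graph_of_def)
    then have "opt irdf T \<le> enat w" unfolding opt_def by (auto intro: least_weight_le)
    then show "sum f (set (leaves T)) \<le> w" by (simp add: f)
  qed
  then show ?thesis by (simp add: f)
qed

section \<open>Reasoning about programs with running times\<close>

text \<open>A weakest precondition for total correctness whose postcondition sees the running time.\<close>

definition halts :: "com \<Rightarrow> state \<Rightarrow> (nat \<Rightarrow> state \<Rightarrow> bool) \<Rightarrow> bool" where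
  "halts c s Q \<longleftrightarrow> (\<exists>t s'. exec c s t s' \<and> Q t s')"

lemma halts_simps:
  "halts SKIP s Q \<longleftrightarrow> Q 1 s"
  "halts (x :=\<^sub>r e) s Q \<longleftrightarrow> Q (1 + expr_cost e) (set_reg x (eval e s) s)"
  "halts (A \<bullet> i :=\<^sub>a e) s Q \<longleftrightarrow>
    Q (1 + expr_cost i + expr_cost e) (set_cell A (the_enat (eval i s)) (eval e s) s)"
  "halts (c1 ;; c2) s Q \<longleftrightarrow> halts c1 s (\<lambda>t1 s1. halts c2 s1 (\<lambda>t2. Q (t1 + t2)))"
  "halts (IF b THEN c1 ELSE c2) s Q \<longleftrightarrow>
    (if holds b s then halts c1 s (\<lambda>t. Q (1 + test_cost b + t))
     else halts c2 s (\<lambda>t. Q (1 + test_cost b + t)))"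
proof -
  show "halts SKIP s Q \<longleftrightarrow> Q 1 s"
    unfolding halts_def by (metis One_nat_def SkipE exec.Skip)
  show "halts (x :=\<^sub>r e) s Q \<longleftrightarrow> Q (1 + expr_cost e) (set_reg x (eval e s) s)"
    unfolding halts_def by (metis AssignE exec.Assign plus_1_eq_Suc)
  show "halts (A \<bullet> i :=\<^sub>a e) s Q \<longleftrightarrow>
    Q (1 + expr_cost i + expr_cost e) (set_cell A (the_enat (eval i s)) (eval e s) s)"
    unfolding halts_def by (metis StoreE exec.Store plus_1_eq_Suc add_Suc)
  show "halts (c1 ;; c2) s Q \<longleftrightarrow> halts c1 s (\<lambda>t1 s1. halts c2 s1 (\<lambda>t2. Q (t1 + t2)))"
    unfolding halts_def by (blast elim: SeqE intro: exec.Seq)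
  have "exec (IF b THEN c1 ELSE c2) s t s' \<longleftrightarrow>
      (\<exists>u. t = 1 + test_cost b + u \<and> exec (if holds b s then c1 else c2) s u s')" for t s'
    by (auto elim!: IfE intro: exec.IfTrue[simplified] exec.IfFalse[simplified])
  then show "halts (IF b THEN c1 ELSE c2) s Q \<longleftrightarrow>
    (if holds b s then halts c1 s (\<lambda>t. Q (1 + test_cost b + t))
     else halts c2 s (\<lambda>t. Q (1 + test_cost b + t)))"
    unfolding halts_def by (cases "holds b s") auto
qed

lemma halts_mono: "halts c s P \<Longrightarrow> (\<And>t s'. P t s' \<Longrightarrow> Q t s') \<Longrightarrow> halts c s Q"
  unfolding halts_def by blast

text \<open>As a congruence rule this keeps the simplifier from entering the postcondition before the
  current state is in normal form; otherwise the state, which occurs several times in each of its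
  updates, would grow exponentially during symbolic execution.\<close>

lemma halts_weak_cong: "s = s' \<Longrightarrow> halts c s Q \<longleftrightarrow> halts c s' Q"
  by simp

text \<open>The bound \<open>k\<close> on the cost of one pass and the variant \<open>\<mu>\<close> on the number of
  remaining passes give the running time.\<close>

lemma halts_While:
  fixes \<mu> :: "state \<Rightarrow> nat"
  assumes step: "\<And>s. I s \<Longrightarrow> holds b s \<Longrightarrow> halts c s (\<lambda>t s'. t \<le> k \<and> I s' \<and> \<mu> s' < \<mu> s)"
    and "I s"
  shows "halts (WHILE b DO c) s
    (\<lambda>t s'. t \<le> Suc (\<mu> s) * (1 + test_cost b + k) \<and> I s' \<and> \<not> holds b s')"
  using \<open>I s\<close>
proof (induction "\<mu> s" arbitrary: s rule: less_induct)
  case less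
  show ?case
  proof (cases "holds b s")
    case False
    moreover have "1 + test_cost b \<le> Suc (\<mu> s) * (1 + test_cost b + k)" by simp
    ultimately show ?thesis using less.prems exec.WhileFalse[OF False, of c]
      unfolding halts_def by blast
  next
    case True
    obtain t s' where t: "exec c s t s'" "t \<le> k" "I s'" "\<mu> s' < \<mu> s"
      using step[OF less.prems True] unfolding halts_def by blast
    obtain t2 s2 where t2: "exec (WHILE b DO c) s' t2 s2"
      "t2 \<le> Suc (\<mu> s') * (1 + test_cost b + k)" "I s2" "\<not> holds b s2"
      using less.hyps[OF t(4) t(3)] unfolding halts_def by blast
    have "Suc (\<mu> s') * (1 + test_cost b + k) \<le> \<mu> s * (1 + test_cost b + k)"
      using t(4) by (intro mult_right_mono) auto
    then have "1 + test_cost b + t + t2 \<le> Suc (\<mu> s) * (1 + test_cost b + k)"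
      using t(2) t2(2) by simp
    then show ?thesis
      using exec.WhileTrue[OF True t(1) t2(1)] t2 unfolding halts_def by blast
  qed
qed

text \<open>The effect of handling one internal node, before its domination number is written.\<close>

definition combined :: "nat \<Rightarrow> 'a dtree \<Rightarrow> state \<Rightarrow> state \<Rightarrow> bool" where
  "combined y N s s' \<longleftrightarrow> fst s' = fst s \<and>
    (\<forall>A z. z \<noteq> y \<longrightarrow> snd s' A z = snd s A z) \<and>
    (\<forall>A\<in>{Kind, LeftOf, RightOf, Order}. snd s' A = snd s A) \<and>
    snd s' U00 y = opt twin00 N \<and> snd s' U0 y = opt twin0 N \<and>
    snd s' U1 y = opt twin1 N \<and> snd s' U2 y = opt twin2 N"

text \<open>The cells of the children must differ from the cell \<open>y\<close> because the quantities of
  \<open>y\<close> are written one by one while those of the children are still being read.\<close>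

lemma combine_correct:
  assumes regs: "fst s Cur = enat y" "fst s Lft = enat a" "fst s Rgt = enat b"
    and ne: "a \<noteq> y" "b \<noteq> y" and kind: "snd s Kind y = op_code p"
    and disj: "set (leaves l) \<inter> set (leaves r) = {}"
    and left: "snd s U00 a = opt twin00 l" "snd s U0 a = opt twin0 l"
      "snd s U1 a = opt twin1 l" "snd s U2 a = opt twin2 l" "snd s IR a = opt irdf l"
    and right: "snd s U00 b = opt twin00 r" "snd s U0 b = opt twin0 r"
      "snd s U1 b = opt twin1 r" "snd s U2 b = opt twin2 r" "snd s IR b = opt irdf r"
  shows "halts (IF Kind \<bullet> Cur [=] Const 1 THEN true_twin_step
      ELSE IF Kind \<bullet> Cur [=] Const 2 THEN false_twin_step
      ELSE attachment_step) s (\<lambda>t s'. t \<le> 90 \<and> combined y (Node p l r) s s')"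
proof -
  note sym = set_reg_def set_cell_def combined_def
  have "halts true_twin_step s (\<lambda>t s'. t \<le> 80 \<and> combined y (Node TrueTwin l r) s s')"
    unfolding true_twin_step_def
    by (simp cong: halts_weak_cong
        add: halts_simps sym regs ne left right opt_TrueTwin[OF disj])
  moreover have "halts false_twin_step s (\<lambda>t s'. t \<le> 80 \<and> combined y (Node FalseTwin l r) s s')"
    unfolding false_twin_step_def
    by (simp cong: halts_weak_cong
        add: halts_simps sym regs ne left right opt_FalseTwin[OF disj])
  moreover have "halts attachment_step s (\<lambda>t s'. t \<le> 80 \<and> combined y (Node Attachment l r) s s')"
    unfolding attachment_step_def
    by (simp cong: halts_weak_cong
        add: halts_simps sym regs ne left right opt_Attachment[OF disj])
  ultimately show ?thesis
    using kind by (cases p) (auto simp: halts_simps regs elim!: halts_mono)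
qed

section \<open>The stored tree\<close>

fun inner_nodes :: "'a dtree \<Rightarrow> nat" where
  "inner_nodes (Leaf v) = 0"
| "inner_nodes (Node p l r) = Suc (inner_nodes l + inner_nodes r)"

lemma Suc_inner_nodes: "Suc (inner_nodes T) = length (leaves T)"
  by (induction T) auto

text \<open>A global description of the memory by a function \<open>\<tau>\<close> from addresses to subtrees.  Unlike
  \<^term>\<open>stored_at\<close> it says nothing about separation; that the children of \<open>y\<close> lie at other
  addresses follows from \<open>\<tau> y\<close> being larger than its subtrees.\<close>

definition linked :: "state \<Rightarrow> nat set \<Rightarrow> (nat \<Rightarrow> 'a dtree) \<Rightarrow> bool" where
  "linked s A \<tau> \<longleftrightarrow> (\<forall>y\<in>A. case \<tau> y of
      Leaf v \<Rightarrow> snd s Kind y = 0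
    | Node p l r \<Rightarrow> snd s Kind y = op_code p \<and>
        (\<exists>a\<in>A. snd s LeftOf y = enat a \<and> \<tau> a = l) \<and> (\<exists>b\<in>A. snd s RightOf y = enat b \<and> \<tau> b = r))"

lemma stored_at_linked:
  assumes "stored_at s x T A"
  shows "\<exists>\<tau>. linked s A \<tau> \<and> x \<in> A \<and> \<tau> x = T \<and> finite A \<and> card A < 2 * length (leaves T) \<and>
    (distinct (leaves T) \<longrightarrow> (\<forall>y\<in>A. distinct (leaves (\<tau> y))))"
  using assms
proof induction
  case (1 x v)
  then show ?case by (intro exI[of _ "\<lambda>_. Leaf v"]) (auto simp: linked_def)
next
  case (2 x p y l A z r B)
  obtain \<tau>1 where t1: "linked s A \<tau>1" "y \<in> A" "\<tau>1 y = l" "finite A" "card A < 2 * length (leaves l)"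
    "distinct (leaves l) \<longrightarrow> (\<forall>y\<in>A. distinct (leaves (\<tau>1 y)))" using "2.IH"(1) by blast
  obtain \<tau>2 where t2: "linked s B \<tau>2" "z \<in> B" "\<tau>2 z = r" "finite B" "card B < 2 * length (leaves r)"
    "distinct (leaves r) \<longrightarrow> (\<forall>y\<in>B. distinct (leaves (\<tau>2 y)))" using "2.IH"(2) by blast
  define \<tau> where "\<tau> a = (if a \<in> A then \<tau>1 a else if a \<in> B then \<tau>2 a else Node p l r)" for a
  have A: "\<tau> a = \<tau>1 a" if "a \<in> A" for a using that by (simp add: \<tau>_def)
  have B: "\<tau> b = \<tau>2 b" if "b \<in> B" for b using that 2 by (auto simp: \<tau>_def)
  have x: "\<tau> x = Node p l r" using 2 by (simp add: \<tau>_def)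
  have "linked s (insert x (A \<union> B)) \<tau>"
    unfolding linked_def
  proof
    fix w assume "w \<in> insert x (A \<union> B)"
    then consider "w = x" | "w \<in> A" | "w \<in> B" by blast
    then show "case \<tau> w of Leaf v \<Rightarrow> snd s Kind w = 0
      | Node p l r \<Rightarrow> snd s Kind w = op_code p \<and>
        (\<exists>a\<in>insert x (A \<union> B). snd s LeftOf w = enat a \<and> \<tau> a = l) \<and>
        (\<exists>b\<in>insert x (A \<union> B). snd s RightOf w = enat b \<and> \<tau> b = r)"
    proof cases
      case 1
      then show ?thesis using x 2 A B t1 t2 by auto
    next
      case 2
      then show ?thesis using t1(1) A unfolding linked_def by (fastforce split: dtree.splits)
    next
      case 3
      then show ?thesis using t2(1) B unfolding linked_def by (fastforce split: dtree.splits)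
    qed
  qed
  moreover have "card (insert x (A \<union> B)) < 2 * length (leaves (Node p l r))"
    using t1 t2 2 by (simp add: card_Un_disjoint)
  ultimately show ?case using x t1 t2 A B by (intro exI[of _ \<tau>]) auto
qed

text \<open>The initial state \<open>s0\<close> stores \<open>T\<close> on the addresses below \<open>m\<close>.\<close>

locale stored_tree =
  fixes s0 :: state and m root :: nat and T :: "'a dtree" and \<tau> :: "nat \<Rightarrow> 'a dtree"
  assumes Root: "fst s0 Root = enat root" and Size: "fst s0 Size = enat m"
    and root: "root < m" "\<tau> root = T" and small: "m < 2 * length (leaves T)"
    and linked: "linked s0 {..<m} \<tau>"
    and disjoint: "y < m \<Longrightarrow> distinct (leaves (\<tau> y))"
begin

definition inner :: "nat \<Rightarrow> bool" where
  "inner y \<longleftrightarrow> y < m \<and> (\<exists>p l r. \<tau> y = Node p l r)"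

definition intact :: "state \<Rightarrow> bool" where
  "intact s \<longleftrightarrow> snd s Kind = snd s0 Kind \<and> snd s LeftOf = snd s0 LeftOf \<and>
    snd s RightOf = snd s0 RightOf \<and> fst s Size = enat m"

lemma innerE:
  assumes "inner y"
  obtains p l r a b where "y < m" "\<tau> y = Node p l r" "snd s0 Kind y = op_code p"
    "snd s0 LeftOf y = enat a" "a < m" "\<tau> a = l" "snd s0 RightOf y = enat b" "b < m" "\<tau> b = r"
    "a \<noteq> y" "b \<noteq> y"
proof -
  obtain p l r where y: "y < m" "\<tau> y = Node p l r" using assms by (auto simp: inner_def)
  then obtain a b where "snd s0 Kind y = op_code p"
    "snd s0 LeftOf y = enat a" "a < m" "\<tau> a = l" "snd s0 RightOf y = enat b" "b < m" "\<tau> b = r"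
    using bspec[OF linked[unfolded linked_def], of y] by auto
  moreover from this have "a \<noteq> y" "b \<noteq> y" using y by auto
  ultimately show thesis using that y by blast
qed

lemma kind_0_iff: "y < m \<Longrightarrow> snd s0 Kind y = 0 \<longleftrightarrow> \<not> inner y"
proof (cases "\<tau> y")
  case (Node p l r)
  assume "y < m"
  then have "inner y" using Node by (auto simp: inner_def)
  then obtain q where "snd s0 Kind y = op_code q" by (rule innerE)
  then show ?thesis using \<open>inner y\<close> by (cases q) auto
next
  case (Leaf v)
  assume "y < m"
  then show ?thesis using Leaf linked by (force simp: linked_def inner_def)
qed

lemma inner_nodes_0: "y < m \<Longrightarrow> \<not> inner y \<Longrightarrow> inner_nodes (\<tau> y) = 0"
  by (cases "\<tau> y") (auto simp: inner_def)

definition child :: "nat \<Rightarrow> nat \<Rightarrow> bool" where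
  "child y c \<longleftrightarrow> snd s0 LeftOf y = enat c \<or> snd s0 RightOf y = enat c"

section \<open>The breadth-first ordering\<close>

text \<open>The number of internal nodes not yet taken from the queue \<open>q\<close>, whose waiting entries are at
  the positions \<open>f, \<dots>, n\<close>: each of them stands for its whole subtree.\<close>

definition pending :: "(nat \<Rightarrow> enat) \<Rightarrow> nat \<Rightarrow> nat \<Rightarrow> nat" where
  "pending q f n = (\<Sum>i\<in>{f..n}. inner_nodes (\<tau> (the_enat (q i))))"

text \<open>Entries before \<open>f\<close> have been expanded: their internal children come later in the queue.  The
  last conjunct counts \<open>f - 1\<close> expanded entries and the pending ones; together they are all internal
  nodes, one fewer than the leaves.  It bounds the length of the queue without any appeal to the
  distinctness of its entries.\<close>

definition queue :: "(nat \<Rightarrow> enat) \<Rightarrow> nat \<Rightarrow> nat \<Rightarrow> bool" where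
  "queue q f n \<longleftrightarrow> 1 \<le> f \<and> f \<le> Suc n \<and> 1 \<le> n \<and> q 1 = enat root \<and>
    (\<forall>i\<in>{1..n}. \<exists>y. q i = enat y \<and> inner y) \<and>
    (\<forall>i\<in>{1..<f}. \<forall>y c. q i = enat y \<longrightarrow> child y c \<longrightarrow> inner c \<longrightarrow> (\<exists>j\<in>{i<..n}. q j = enat c)) \<and>
    f + pending q f n = length (leaves T)"

lemma queue_entry: "queue q f n \<Longrightarrow> 1 \<le> i \<Longrightarrow> i \<le> n \<Longrightarrow> \<exists>y. q i = enat y \<and> inner y"
  by (simp add: queue_def)

text \<open>Expanding the entry at \<open>f\<close> exchanges its subtree for the subtrees of its children.  This
  lowers the pending count by one even if a child is a leaf and not enqueued, because a
  leaf contains no internal node.\<close>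

lemma queue_step:
  assumes q: "queue q f n" "f \<le> n" and y: "q f = enat y"
    and ab: "snd s0 LeftOf y = enat a" "snd s0 RightOf y = enat b"
    and zs: "zs = filter inner [a, b]"
    and old: "\<forall>i\<le>n. q' i = q i" and new: "\<forall>k<length zs. q' (Suc (n + k)) = enat (zs ! k)"
  shows "queue q' (Suc f) (n + length zs)"
proof -
  from q have q': "1 \<le> f" "1 \<le> n" "q 1 = enat root" "\<forall>i\<in>{1..n}. \<exists>y. q i = enat y \<and> inner y"
    "\<forall>i\<in>{1..<f}. \<forall>y c. q i = enat y \<longrightarrow> child y c \<longrightarrow> inner c \<longrightarrow> (\<exists>j\<in>{i<..n}. q j = enat c)"
    "f + pending q f n = length (leaves T)"
    unfolding queue_def by auto
  have "inner y" using q'(1,4) q(2) y by (metis atLeastAtMost_iff enat.inject)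
  then obtain p l r where y': "\<tau> y = Node p l r" "a < m" "b < m" "\<tau> a = l" "\<tau> b = r"
    by (rule innerE) (use ab in auto)
  have pos: "q' i = enat (zs ! (i - Suc n))" if i: "n < i" "i \<le> n + length zs" for i
  proof -
    obtain k where "i = Suc (n + k)" using less_imp_Suc_add[OF i(1)] by blast
    then show ?thesis using new i(2) by simp
  qed
  have new': "\<exists>j\<in>{n<..n + length zs}. q' j = enat c" if c: "c \<in> set zs" for c
  proof -
    obtain k where "k < length zs" "zs ! k = c" using c by (auto simp: in_set_conv_nth)
    then show ?thesis using new by (intro bexI[of _ "Suc (n + k)"]) auto
  qed
  have ent: "\<exists>y. q' i = enat y \<and> inner y" if i: "i \<in> {1..n + length zs}" for i
  proof (cases "i \<le> n")
    case True
    then show ?thesis using q'(4) old i by auto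
  next
    case False
    then have "i - Suc n < length zs" "q' i = enat (zs ! (i - Suc n))" using pos[of i] i by auto
    moreover have "z \<in> set zs \<Longrightarrow> inner z" for z unfolding zs set_filter by blast
    then have "inner (zs ! (i - Suc n))" using nth_mem[OF \<open>i - Suc n < length zs\<close>] by blast
    ultimately show ?thesis by blast
  qed
  have chi: "\<exists>j\<in>{i<..n + length zs}. q' j = enat c"
    if i: "i \<in> {1..<Suc f}" "q' i = enat w" "child w c" "inner c" for i w c
  proof (cases "i = f")
    case True
    then have "w = y" using i old q(2) y by auto
    then have "c \<in> set zs" using i ab zs unfolding child_def by auto
    then obtain j where "j \<in> {n<..n + length zs}" "q' j = enat c" using new' by blast
    then show ?thesis using True q(2) by (intro bexI[of _ j]) auto
  next
    case False
    then have "i \<in> {1..<f}" "q i = enat w" using i old q(2) by auto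
    then obtain j where "j \<in> {i<..n}" "q j = enat c" using q'(5) i(3,4) by blast
    then show ?thesis using old by (intro bexI[of _ j]) auto
  qed
  have "{Suc f..n + length zs} = {Suc f..n} \<union> {Suc n..n + length zs}" using q(2) by auto
  then have "pending q' (Suc f) (n + length zs) =
      (\<Sum>i\<in>{Suc f..n}. inner_nodes (\<tau> (the_enat (q' i)))) +
      (\<Sum>i\<in>{Suc n..n + length zs}. inner_nodes (\<tau> (the_enat (q' i))))"
    unfolding pending_def by (simp add: sum.union_disjoint)
  also have "(\<Sum>i\<in>{Suc f..n}. inner_nodes (\<tau> (the_enat (q' i)))) = pending q (Suc f) n"
    unfolding pending_def using old by (intro sum.cong) auto
  also have "(\<Sum>i\<in>{Suc n..n + length zs}. inner_nodes (\<tau> (the_enat (q' i)))) =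
      (\<Sum>k<length zs. inner_nodes (\<tau> (zs ! k)))"
    using pos by (intro sum.reindex_bij_witness[of _ "\<lambda>k. Suc (n + k)" "\<lambda>i. i - Suc n"]) auto
  also have "\<dots> = inner_nodes l + inner_nodes r"
    using inner_nodes_0[of a] inner_nodes_0[of b] y' unfolding zs
    by (auto simp: lessThan_Suc numeral_2_eq_2)
  finally have new_pending:
    "pending q' (Suc f) (n + length zs) = pending q (Suc f) n + (inner_nodes l + inner_nodes r)" .
  have "pending q f n = inner_nodes (\<tau> y) + pending q (Suc f) n"
    unfolding pending_def using q(2) y by (simp add: sum.atLeast_Suc_atMost)
  then have "Suc f + pending q' (Suc f) (n + length zs) = length (leaves T)"
    using q'(6) y' new_pending by simp
  moreover have "q' 1 = enat root" using old q'(2,3) by simp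
  moreover have "1 \<le> Suc f" "Suc f \<le> Suc (n + length zs)" "1 \<le> n + length zs"
    using q(2) q'(2) by auto
  ultimately show ?thesis unfolding queue_def using ent chi by blast
qed

definition bfs_invariant :: "state \<Rightarrow> bool" where
  "bfs_invariant s \<longleftrightarrow> intact s \<and>
    (\<exists>f n. fst s First = enat f \<and> fst s Last = enat n \<and> queue (snd s Order) f n)"

lemma bfs_ordering_correct:
  assumes "inner root"
  shows "halts bfs_ordering s0 (\<lambda>t s. t \<le> 60 * length (leaves T) + 20 \<and> intact s \<and>
    (\<exists>n. fst s Last = enat n \<and> n < length (leaves T) \<and> queue (snd s Order) (Suc n) n))"
proof -
  let ?\<mu> = "\<lambda>s. pending (snd s Order) (the_enat (fst s First)) (the_enat (fst s Last))"
  define s1 where "s1 = set_reg Last 1 (set_reg First 1 (set_cell Order 1 (enat root) s0))"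
  have \<mu>1: "pending (snd s1 Order) 1 1 = inner_nodes T"
    by (simp add: pending_def root s1_def set_reg_def set_cell_def)
  have "queue (snd s1 Order) 1 1"
    unfolding queue_def \<mu>1 using assms
    by (auto simp: s1_def set_reg_def set_cell_def Suc_inner_nodes)
  then have init: "bfs_invariant s1"
    by (auto simp: bfs_invariant_def s1_def set_reg_def set_cell_def intact_def Size one_enat_def)
  have \<mu>: "?\<mu> s1 = inner_nodes T"
    using \<mu>1 by (simp add: s1_def set_reg_def set_cell_def one_enat_def)
  show ?thesis
    unfolding bfs_ordering_def halts_simps eval.simps Root s1_def[symmetric]
      the_enat.simps[of 1, folded one_enat_def]
  proof (rule halts_mono, rule halts_While[where I = bfs_invariant and k = 50 and \<mu> = ?\<mu>],
      goal_cases)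
    case (1 s)
    then obtain f n where s: "intact s" "fst s First = enat f" "fst s Last = enat n"
      "queue (snd s Order) f n" "f \<le> n"
      by (auto simp: bfs_invariant_def one_enat_def)
    then have "1 \<le> f" by (simp add: queue_def)
    then obtain y where y: "snd s Order f = enat y" "inner y" using queue_entry s(4,5) by blast
    then obtain a b where ab: "snd s0 LeftOf y = enat a" "snd s0 RightOf y = enat b" "a < m" "b < m"
      by (elim innerE)
    define zs where "zs = filter inner [a, b]"
    have kind: "snd s0 Kind a = 0 \<longleftrightarrow> \<not> inner a" "snd s0 Kind b = 0 \<longleftrightarrow> \<not> inner b"
      using kind_0_iff ab by auto
    have i: "snd s Kind = snd s0 Kind" "snd s LeftOf = snd s0 LeftOf"
      "snd s RightOf = snd s0 RightOf" "fst s Size = enat m"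
      using s(1) by (auto simp: intact_def)
    show ?case
    proof (rule halts_mono[where P = "\<lambda>t s'. t \<le> 50 \<and> fst s' First = enat (Suc f) \<and>
        fst s' Last = enat (n + length zs) \<and> intact s' \<and>
        (\<forall>i\<le>n. snd s' Order i = snd s Order i) \<and>
        (\<forall>k<length zs. snd s' Order (Suc (n + k)) = enat (zs ! k))"], goal_cases)
      case 1
      show ?case
        by (cases "inner a"; cases "inner b")
          (simp_all cong: halts_weak_cong add: halts_simps s y ab i kind zs_def intact_def
            set_reg_def set_cell_def one_enat_def All_less_Suc2)
    next
      case (2 t s')
      then have Q: "queue (snd s' Order) (Suc f) (n + length zs)"
        using queue_step[OF s(4,5) y(1) ab(1,2) zs_def] by blast
      then have "Suc f + pending (snd s' Order) (Suc f) (n + length zs) = f + pending (snd s Order) f n"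
        using s(4) by (simp add: queue_def)
      then show ?case using 2 Q s by (auto simp: bfs_invariant_def)
    qed
  next
    case 2
    show ?case by (rule init)
  next
    case (3 t s)
    then obtain f n where s: "intact s" "fst s First = enat f" "fst s Last = enat n"
      "queue (snd s Order) f n" "\<not> f \<le> n"
      by (auto simp: bfs_invariant_def one_enat_def)
    then have "f = Suc n" by (simp add: queue_def)
    moreover have "f \<le> length (leaves T)" using s(4) by (simp add: queue_def)
    ultimately show ?case using 3 s unfolding \<mu> Suc_inner_nodes by auto
  qed
qed

section \<open>Correctness of the algorithm\<close>

definition solved :: "state \<Rightarrow> nat \<Rightarrow> bool" where
  "solved s y \<longleftrightarrow> snd s U00 y = opt twin00 (\<tau> y) \<and> snd s U0 y = opt twin0 (\<tau> y) \<and>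
    snd s U1 y = opt twin1 (\<tau> y) \<and> snd s U2 y = opt twin2 (\<tau> y) \<and> snd s IR y = opt irdf (\<tau> y)"

lemma init_leaves_correct:
  assumes "intact s1"
  shows "halts init_leaves s1 (\<lambda>t s. t \<le> 40 * m + 50 \<and> intact s \<and>
    fst s Last = fst s1 Last \<and> snd s Order = snd s1 Order \<and> (\<forall>y<m. \<not> inner y \<longrightarrow> solved s y))"
proof -
  define I where "I s \<longleftrightarrow> intact s \<and> fst s Last = fst s1 Last \<and> snd s Order = snd s1 Order \<and>
    (\<exists>k\<le>m. fst s Cur = enat k \<and> (\<forall>y<k. \<not> inner y \<longrightarrow> solved s y))" for s
  show ?thesis
    unfolding init_leaves_def halts_simps
  proof (rule halts_mono, rule halts_While[where I = I and k = 33 and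
        \<mu> = "\<lambda>s. m - the_enat (fst s Cur)"], goal_cases)
    case (1 s)
    then obtain k where s: "intact s" "fst s Last = fst s1 Last" "snd s Order = snd s1 Order"
      "fst s Cur = enat k" "k < m" "\<And>y. y < k \<Longrightarrow> \<not> inner y \<Longrightarrow> solved s y"
      by (auto simp: I_def intact_def)
    have i: "snd s Kind = snd s0 Kind" "snd s LeftOf = snd s0 LeftOf"
      "snd s RightOf = snd s0 RightOf" "fst s Size = enat m"
      using s(1) by (auto simp: intact_def)
    have k: "Suc k \<le> m" "m - Suc k < m - k" using s(5) by auto
    have leaf: "\<exists>v. \<tau> k = Leaf v" if "\<not> inner k"
      using that s(5) by (cases "\<tau> k") (auto simp: inner_def)
    have old: "opt twin00 (\<tau> y) = snd s U00 y" "opt twin0 (\<tau> y) = snd s U0 y"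
      "opt twin1 (\<tau> y) = snd s U1 y" "opt twin2 (\<tau> y) = snd s U2 y" "opt irdf (\<tau> y) = snd s IR y"
      if "y < k" "\<not> inner y" for y using s(6)[OF that] by (simp_all add: solved_def)
    show ?case
    proof (cases "inner k")
      case True
      then show ?thesis
        by (auto cong: halts_weak_cong simp: halts_simps s k i kind_0_iff I_def intact_def
            set_reg_def set_cell_def one_enat_def solved_def old less_Suc_eq)
    next
      case False
      with leaf obtain v where "\<tau> k = Leaf v" by blast
      with False show ?thesis
        by (auto cong: halts_weak_cong simp: halts_simps s k i kind_0_iff I_def intact_def
            set_reg_def set_cell_def one_enat_def solved_def old less_Suc_eq opt_Leaf)
    qed
  next
    case 2
    show ?case using assms by (simp add: I_def intact_def set_reg_def zero_enat_def)
  next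
    case (3 t s)
    then show ?case using assms by (auto simp: I_def intact_def set_reg_def zero_enat_def)
  qed
qed

lemma children_disjoint:
  assumes "y < m" "\<tau> y = Node p l r"
  shows "set (leaves l) \<inter> set (leaves r) = {}"
  using disjoint[OF assms(1)] assms(2) by simp

text \<open>The loop runs through the breadth-first ordering of length \<open>n\<close> backwards; the positions above
  the counter are finished.  The leaves count as finished from the start.\<close>

definition loop_invariant :: "state \<Rightarrow> nat \<Rightarrow> state \<Rightarrow> bool" where
  "loop_invariant s1 n s \<longleftrightarrow> intact s \<and> snd s Order = snd s1 Order \<and>
    (\<forall>y<m. \<not> inner y \<longrightarrow> solved s y) \<and>
    (\<exists>k\<le>n. fst s Count = enat k \<and> (\<forall>i\<in>{k<..n}. solved s (the_enat (snd s Order i))))"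

text \<open>Writing the correct values into a cell never spoils a solved cell: if the address recurs in the
  ordering, the same values are written again.\<close>

lemma loop_invariant_step:
  assumes s: "loop_invariant s1 n s"
    and k: "fst s Count = enat (Suc k)" and y: "snd s Order (Suc k) = enat y"
    and s': "intact s'" "snd s' Order = snd s Order" "fst s' Count = enat k"
    and other: "\<And>A z. z \<noteq> y \<Longrightarrow> snd s' A z = snd s A z"
    and "solved s' y"
  shows "loop_invariant s1 n s'"
proof -
  have le: "Suc k \<le> n" and later: "\<And>i. i \<in> {Suc k<..n} \<Longrightarrow> solved s (the_enat (snd s Order i))"
    and leaves: "\<And>z. z < m \<Longrightarrow> \<not> inner z \<Longrightarrow> solved s z" and O: "snd s Order = snd s1 Order"
    using s k by (auto simp: loop_invariant_def)
  have keep: "solved s' z" if "solved s z" for z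
    using that \<open>solved s' y\<close> other[of z] by (cases "z = y") (simp_all add: solved_def)
  have "solved s' (the_enat (snd s' Order i))" if "i \<in> {k<..n}" for i
    using that later[of i] keep \<open>solved s' y\<close> y s'(2) by (cases "i = Suc k") auto
  then show ?thesis
    unfolding loop_invariant_def using s' O le keep leaves by auto
qed

text \<open>An internal child stands at a later position of the ordering than its parent, hence among the
  finished ones.\<close>

lemma children_solved:
  assumes q: "queue (snd s1 Order) (Suc n) n" and s: "loop_invariant s1 n s"
    and k: "fst s Count = enat (Suc k)" and y: "snd s Order (Suc k) = enat y"
    and c: "child y c" "c < m"
  shows "solved s c"
proof (cases "inner c")
  case True
  have le: "Suc k \<le> n" and O: "snd s Order = snd s1 Order"
    using s k by (auto simp: loop_invariant_def)
  then obtain j where "j \<in> {Suc k<..n}" "snd s Order j = enat c"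
    using q y c True unfolding queue_def by (metis O atLeastLessThan_iff le_imp_less_Suc le_add1 plus_1_eq_Suc)
  then show ?thesis using s k by (force simp: loop_invariant_def)
qed (use s c in \<open>simp add: loop_invariant_def\<close>)

lemma irdn_algorithm_correct:
  assumes "inner root"
  shows "halts irdn_algorithm s0 (\<lambda>t s. fst s Res = opt irdf T \<and> t \<le> 600 * length (leaves T))"
  unfolding irdn_algorithm_def halts_simps(4)
proof (rule halts_mono[OF bfs_ordering_correct[OF assms]], goal_cases)
  case (1 t1 s1)
  then obtain n where t1: "t1 \<le> 60 * length (leaves T) + 20" and s1: "intact s1"
    and n: "fst s1 Last = enat n" "n < length (leaves T)" and q1: "queue (snd s1 Order) (Suc n) n"
    by blast
  show ?case
  proof (rule halts_mono[OF init_leaves_correct[OF s1]], goal_cases)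
    case (1 t2 s2)
    then have t2: "t2 \<le> 40 * m + 50" and s2: "intact s2" "fst s2 Last = enat n"
      "\<forall>y<m. \<not> inner y \<longrightarrow> solved s2 y" and q: "queue (snd s2 Order) (Suc n) n"
      using n q1 by simp_all
    show ?case
      unfolding halts_simps(2)
    proof (rule halts_mono, rule halts_While[where I = "loop_invariant s2 n" and k = 150 and
        \<mu> = "\<lambda>s. the_enat (fst s Count)"], goal_cases)
      case (1 s)
      then obtain k where k: "fst s Count = enat (Suc k)" "Suc k \<le> n"
        by (auto simp: loop_invariant_def zero_enat_def gr0_conv_Suc)
      have i: "snd s Kind = snd s0 Kind" "snd s LeftOf = snd s0 LeftOf"
        "snd s RightOf = snd s0 RightOf" "fst s Size = enat m" and O: "snd s Order = snd s2 Order"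
        using 1 by (auto simp: loop_invariant_def intact_def)
      obtain y where y: "snd s Order (Suc k) = enat y" "inner y"
        using queue_entry[OF q, of "Suc k"] k O by auto
      obtain p l r a b where node: "y < m" "\<tau> y = Node p l r" "snd s0 Kind y = op_code p"
        "snd s0 LeftOf y = enat a" "a < m" "\<tau> a = l" "snd s0 RightOf y = enat b" "b < m" "\<tau> b = r"
        "a \<noteq> y" "b \<noteq> y"
        using innerE[OF y(2)] by metis
      have "solved s a" "solved s b"
        using children_solved[OF q 1(1) k(1) y(1)] node by (auto simp: child_def)
      then have val: "snd s U00 a = opt twin00 l" "snd s U0 a = opt twin0 l"
        "snd s U1 a = opt twin1 l" "snd s U2 a = opt twin2 l" "snd s IR a = opt irdf l"
        "snd s U00 b = opt twin00 r" "snd s U0 b = opt twin0 r"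
        "snd s U1 b = opt twin1 r" "snd s U2 b = opt twin2 r" "snd s IR b = opt irdf r"
        using node by (simp_all add: solved_def)
      have disj: "set (leaves l) \<inter> set (leaves r) = {}" using children_disjoint node by blast
      have dec: "enat (Suc k) - 1 = enat k" by (simp add: one_enat_def)
      show ?case
      proof (rule halts_mono[where P = "\<lambda>t s'. t \<le> 150 \<and> intact s' \<and>
          snd s' Order = snd s Order \<and> fst s' Count = enat k \<and>
          (\<forall>A z. z \<noteq> y \<longrightarrow> snd s' A z = snd s A z) \<and> solved s' y"], goal_cases)
        case 1
        let ?s = "((fst s)(Cur := enat y, Lft := enat a, Rgt := enat b), snd s)"
        have step: "halts (IF Kind \<bullet> Cur [=] Const 1 THEN true_twin_step
          ELSE IF Kind \<bullet> Cur [=] Const 2 THEN false_twin_step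
          ELSE attachment_step) ?s (\<lambda>t s'. t \<le> 90 \<and> combined y (Node p l r) ?s s')"
          using val node by (intro combine_correct disj) (simp_all add: i)
        show ?case
          unfolding halts_simps(2,4)
          by (simp add: k y i node(4,7) set_reg_def set_cell_def, rule halts_mono[OF step])
            (auto simp: combined_def halts_simps set_cell_def k dec solved_def intact_def i node(2)
              opt_irdf[of "Node p l r"] min.assoc)
      next
        case (2 t s')
        then have "loop_invariant s2 n s'"
          using loop_invariant_step[OF 1(1) k(1) y(1)] by blast
        then show ?case using 2 k by simp
      qed
    next
      case 2
      show ?case using s2
        by (auto simp: loop_invariant_def intact_def solved_def set_reg_def)
    next
      case (3 t s)
      then have s: "snd s Order = snd s2 Order" "\<forall>i\<in>{0<..n}. solved s (the_enat (snd s Order i))"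
        by (auto simp: loop_invariant_def zero_enat_def)
      have "t \<le> Suc n * 154" using 3 s2 by (simp add: set_reg_def)
      \<comment> \<open>Needed to absorb the additive constants.\<close>
      moreover have "2 \<le> length (leaves T)"
        using assms root by (cases T) (auto simp: inner_def Suc_inner_nodes[symmetric])
      \<comment> \<open>2 and 4 are the costs of the assignments before and after the loop.\<close>
      ultimately have "t1 + (t2 + (2 + (t + 4))) \<le> 600 * length (leaves T)"
        using t1 t2 n(2) small by simp
      moreover have "solved s root" using bspec[OF s(2), of 1] s(1) q by (simp add: queue_def)
      ultimately show ?case
        using s q by (simp add: solved_def root queue_def set_reg_def one_enat_def)
    qed
  qed
qed

end

lemma stores_stored_tree:
  assumes "stores s T" "distinct (leaves T)"
  obtains m root \<tau> where "stored_tree s m root T \<tau>"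
proof -
  obtain x m where s: "fst s Root = enat x" "fst s Size = enat m" "stored_at s x T {..<m}"
    using assms(1) unfolding stores_def by blast
  obtain \<tau> where "linked s {..<m} \<tau>" "x \<in> {..<m}" "\<tau> x = T" "card {..<m} < 2 * length (leaves T)"
    "\<forall>y\<in>{..<m}. distinct (leaves (\<tau> y))"
    using stored_at_linked[OF s(3)] assms(2) by blast
  then have "stored_tree s m x T \<tau>" using s by unfold_locales auto
  then show thesis by (rule that)
qed

theorem theorem2p1:
  shows "\<exists>c :: nat. \<forall>(G :: 'a pair_pre_digraph) (T :: 'a dtree) (s :: state).
    pair_graph G \<and> 2 \<le> card (pverts G) \<and> distance_hereditary G \<and>
    decomposition_tree T G \<and> stores s T \<longrightarrow>
    (\<exists>t s'. exec irdn_algorithm s t s' \<and>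
            fst s' Res = enat (iR G) \<and>
            t \<le> c * card (pverts G))"
proof (rule exI[of _ 600], intro allI impI)
  fix G :: "'a pair_pre_digraph" and T :: "'a dtree" and s :: state
  assume "pair_graph G \<and> 2 \<le> card (pverts G) \<and> distance_hereditary G \<and>
    decomposition_tree T G \<and> stores s T"
  then have card: "2 \<le> card (pverts G)" and T: "distinct (leaves T)" "graph_of T = G"
    and "stores s T"
    by (auto simp: decomposition_tree_def)
  then have len: "length (leaves T) = card (pverts G)"
    by (auto simp: graph_of_def distinct_card)
  obtain m root \<tau> where "stored_tree s m root T \<tau>"
    using stores_stored_tree[OF \<open>stores s T\<close> T(1)] .
  then interpret stored_tree s m root T \<tau> .
  \<comment> \<open>With at least two vertices the root is internal, as the search presupposes.\<close>
  have "inner root" using card len root by (cases T) (auto simp: inner_def)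
  then obtain t s' where "exec irdn_algorithm s t s'" "fst s' Res = opt irdf T"
    "t \<le> 600 * length (leaves T)"
    using irdn_algorithm_correct unfolding halts_def by blast
  then show "\<exists>t s'. exec irdn_algorithm s t s' \<and> fst s' Res = enat (iR G) \<and> t \<le> 600 * card (pverts G)"
    using opt_irdf_eq_iR[OF T(1)] T(2) len by metis
qed

end
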